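(* Let $F$ be an acceptable family of elliptic curves and let $N(F;X)$ be the number of elliptic curves in $F$ with height less than $X$. Then $$N(F;X)=\big(\mathrm{Vol}(R^+)+\mathrm{Vol}(R^-)\big)X^{5/6}\prod_pM_p(U_1,F)+o(X^{5/6}).$$
   Context: Every elliptic curve over $\mathbb{Q}$ is isomorphic to a unique $E(A,B):y^2=x^3+Ax+B$ with $A,B\in\mathbb{Z}$ and no prime $p$ with $p^4\mid A$, $p^6\mid B$. Set $I(E)=-3A$, $J(E)=-27B$, $H(E)=\max\{|I(E)|^3,J(E)^2/4\}$. A family $F$ is defined by local conditions: $F=\{E:(I(E),J(E))\in\Sigma_p\text{ for all }p\}$ for some $\Sigma_p\subseteq\mathbb{Z}_p^2$. $F^{\mathrm{inv}}=\{(I(E),J(E)):E\in F\}$, $F_p^{\mathrm{inv}}$ is its closure in $\mathbb{Z}_p^2$, and $F_p$ is the set of elliptic curves $y^2=x^3-\frac I3x-\frac J{27}$ over $\mathbb{Q}_p$ with $(I,J)\in F_p^{\mathrm{inv}}$. $F$ is acceptable at $p$ if $F_p$ contains all elliptic curves over $\mathbb{Q}_p$ whose discriminant is not divisible by $p^2$ (all $y^2=x^3+Ax+B$, $A,B\in\mathbb{Z}_p$, $p^2\nmid16(4A^3+27B^2)$); $F$ is acceptable if it is acceptable at all sufficiently large $p$. $M_p(U_1,F)=\int_{F_p^{\mathrm{inv}}}dI\,dJ$, with Haar measure on $\mathbb{Z}_p^2$ normalized to total mass $1$. $R^{\pm}=\{(I,J)\in\mathbb{R}^2:\max\{|I|^3,J^2/4\}<1,\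 \pm(4I^3-J^2)>0\}$ and $\mathrm{Vol}$ is Lebesgue measure.
   Formalization: The local conditions Σ_p are required to have boundary of Haar measure zero at every p and to be closed for all sufficiently large p; for arbitrary subsets Σ_p of Z_p^2 the claim fails (a density-zero family that is p-adically dense for every p can be cut out by Σ_2 alone). *)

theory Defs
  imports
    "HOL-Algebra.Ring"
    "HOL-Algebra.Divisibility"
    "HOL-Probability.Probability"
    "HOL-Library.Landau_Symbols"
    "HOL-Computational_Algebra.Primes"
begin

section \<open>The ring of p-adic integers\<close>

text \<open>A p-adic integer is the compatible sequence of its residues modulo \<open>p ^ n\<close>, each
  represented in \<open>{0..<p ^ n}\<close>. The type depends on no prime, so that all primes can be
  handled in one statement; the prime only enters through the carrier and the operations.\<close>

definition Zp :: "nat \<Rightarrow> (nat \<Rightarrow> int) ring" where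
  "Zp p = \<lparr>carrier = {x. \<forall>n. 0 \<le> x n \<and> x n < int p ^ n \<and> x (Suc n) mod int p ^ n = x n},
     monoid.mult = (\<lambda>x y n. (x n * y n) mod int p ^ n),
     one = (\<lambda>n. 1 mod int p ^ n),
     zero = (\<lambda>_. 0),
     add = (\<lambda>x y n. (x n + y n) mod int p ^ n)\<rparr>"

definition of_int_Zp :: "nat \<Rightarrow> int \<Rightarrow> nat \<Rightarrow> int" where
  "of_int_Zp p k = (\<lambda>n. k mod int p ^ n)"

lemma mod_power_Suc [simp]: "(k::int) mod (p * p ^ n) mod p ^ n = k mod p ^ n"
  by (simp add: mod_mod_cancel)

lemma of_int_Zp_closed: "p > 0 \<Longrightarrow> of_int_Zp p k \<in> carrier (Zp p)"
  by (simp add: Zp_def of_int_Zp_def)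

lemma Zp_carrierD:
  assumes "x \<in> carrier (Zp p)"
  shows "0 \<le> x n" "x n < int p ^ n" "x (Suc n) mod int p ^ n = x n" "x n mod int p ^ n = x n"
  using assms by (auto simp: Zp_def)

lemma Zp_coherent:
  assumes "x \<in> carrier (Zp p)" "m \<le> n"
  shows "x n mod int p ^ m = x m"
  using assms(2)
proof (induction n rule: dec_induct)
  case base
  show ?case using Zp_carrierD[OF assms(1)] by simp
next
  case (step n)
  have "x (Suc n) mod int p ^ m = x (Suc n) mod int p ^ n mod int p ^ m"
    using step by (simp add: mod_mod_cancel le_imp_power_dvd)
  then show ?case using Zp_carrierD[OF assms(1)] step by simp
qed

lemma cring_Zp:
  assumes "p > 0"
  shows "cring (Zp p)"
proof (rule cringI)
  have comp: "(f (Suc n)) mod (int p ^ Suc n) mod int p ^ n = f (Suc n) mod int p ^ n" for f n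
    by simp
  have add: "(x (Suc n) + y (Suc n)) mod int p ^ n = (x n + y n) mod int p ^ n"
    if "x \<in> carrier (Zp p)" "y \<in> carrier (Zp p)" for x y n
    using that by (metis Zp_carrierD(3) mod_add_eq)
  have mult: "(x (Suc n) * y (Suc n)) mod int p ^ n = (x n * y n) mod int p ^ n"
    if "x \<in> carrier (Zp p)" "y \<in> carrier (Zp p)" for x y n
    using that by (metis Zp_carrierD(3) mod_mult_eq)
  show "abelian_group (Zp p)"
  proof (rule abelian_groupI)
    fix x y assume "x \<in> carrier (Zp p)" "y \<in> carrier (Zp p)"
    then show "x \<oplus>\<^bsub>Zp p\<^esub> y \<in> carrier (Zp p)"
      using assms add[of x y] by (simp add: Zp_def)
  next
    fix x assume x: "x \<in> carrier (Zp p)"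
    define y where "y = (\<lambda>n. (- x n) mod int p ^ n)"
    have "(- x (Suc n)) mod int p ^ n = (- x n) mod int p ^ n" for n
      using x by (metis Zp_carrierD(3) mod_minus_eq)
    then have "y \<in> carrier (Zp p)"
      using assms by (simp add: Zp_def y_def)
    moreover have "y \<oplus>\<^bsub>Zp p\<^esub> x = \<zero>\<^bsub>Zp p\<^esub>"
      by (simp add: Zp_def y_def mod_add_left_eq)
    ultimately show "\<exists>y\<in>carrier (Zp p). y \<oplus>\<^bsub>Zp p\<^esub> x = \<zero>\<^bsub>Zp p\<^esub>" by blast
  qed (use assms in \<open>auto simp: Zp_def mod_simps algebra_simps\<close>)
  show "comm_monoid (Zp p)"
  proof (rule comm_monoidI)
    fix x y assume "x \<in> carrier (Zp p)" "y \<in> carrier (Zp p)"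
    then show "x \<otimes>\<^bsub>Zp p\<^esub> y \<in> carrier (Zp p)"
      using assms mult[of x y] by (simp add: Zp_def)
  qed (use assms in \<open>auto simp: Zp_def mod_simps algebra_simps\<close>)
  show "(x \<oplus>\<^bsub>Zp p\<^esub> y) \<otimes>\<^bsub>Zp p\<^esub> z = x \<otimes>\<^bsub>Zp p\<^esub> z \<oplus>\<^bsub>Zp p\<^esub> y \<otimes>\<^bsub>Zp p\<^esub> z" for x y z
    by (auto simp: Zp_def mod_simps algebra_simps)
qed

section \<open>The plane of pairs of p-adic integers and its Haar measure\<close>

definition Zp2 :: "nat \<Rightarrow> ((nat \<Rightarrow> int) \<times> (nat \<Rightarrow> int)) set" where
  "Zp2 p = carrier (Zp p) \<times> carrier (Zp p)"

text \<open>The type class topology on \<open>nat \<Rightarrow> int\<close> is the product of the discrete topologies, so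
  the subspace topology on \<open>carrier (Zp p)\<close> is the p-adic one.\<close>

definition Zp2_top :: "nat \<Rightarrow> ((nat \<Rightarrow> int) \<times> (nat \<Rightarrow> int)) topology" where
  "Zp2_top p = top_of_set (Zp2 p)"

definition translate_Zp2 ::
  "nat \<Rightarrow> (nat \<Rightarrow> int) \<times> (nat \<Rightarrow> int) \<Rightarrow> (nat \<Rightarrow> int) \<times> (nat \<Rightarrow> int) \<Rightarrow> (nat \<Rightarrow> int) \<times> (nat \<Rightarrow> int)" where
  "translate_Zp2 p t z = (fst t \<oplus>\<^bsub>Zp p\<^esub> fst z, snd t \<oplus>\<^bsub>Zp p\<^esub> snd z)"

definition is_normalized_haar :: "nat \<Rightarrow> ((nat \<Rightarrow> int) \<times> (nat \<Rightarrow> int)) measure \<Rightarrow> bool" where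
  "is_normalized_haar p \<mu> \<longleftrightarrow>
     sets \<mu> = sets (restrict_space borel (Zp2 p)) \<and>
     emeasure \<mu> (Zp2 p) = 1 \<and>
     (\<forall>t\<in>Zp2 p. \<forall>S\<in>sets \<mu>. emeasure \<mu> (translate_Zp2 p t ` S) = emeasure \<mu> S)"

text \<open>The choice is harmless: such a measure exists (\<open>haar_Zp2_normalized\<close> below) and is unique,
  like every normalized Haar measure on a compact group.\<close>

definition haar_Zp2 :: "nat \<Rightarrow> ((nat \<Rightarrow> int) \<times> (nat \<Rightarrow> int)) measure" where
  "haar_Zp2 p = (SOME \<mu>. is_normalized_haar p \<mu>)"

definition cyl :: "nat \<Rightarrow> nat \<Rightarrow> int \<Rightarrow> int \<Rightarrow> ((nat \<Rightarrow> int) \<times> (nat \<Rightarrow> int)) set" where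
  "cyl p n a b = {z \<in> Zp2 p. fst z n = a \<and> snd z n = b}"

definition cyls :: "nat \<Rightarrow> ((nat \<Rightarrow> int) \<times> (nat \<Rightarrow> int)) set set" where
  "cyls p = {cyl p n a b | n a b. True}"

lemma cyls_subset: "cyls p \<subseteq> Pow (Zp2 p)"
  by (auto simp: cyls_def cyl_def)

lemma cyl_in_cyls [intro]: "cyl p n a b \<in> cyls p"
  by (auto simp: cyls_def)

lemma countable_cyls: "countable (cyls p)"
proof -
  have "cyls p = (\<lambda>(n, a, b). cyl p n a b) ` UNIV"
    by (auto simp: cyls_def)
  then show ?thesis by simp
qed

lemma cyl_empty:
  assumes "\<not> (0 \<le> a \<and> a < int p ^ n \<and> 0 \<le> b \<and> b < int p ^ n)"
  shows "cyl p n a b = {}"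
  using assms by (auto simp: cyl_def Zp2_def dest: Zp_carrierD(1,2)[of _ p n])

lemma Zp2_eq_cyl: "Zp2 p = cyl p 0 0 0"
proof -
  have "x 0 = 0" if "x \<in> carrier (Zp p)" for x
    using Zp_carrierD(1,2)[OF that, of 0] by simp
  then show ?thesis by (auto simp: cyl_def Zp2_def)
qed

lemma cyl_inter:
  assumes "n \<le> m"
  shows "cyl p n a b \<inter> cyl p m c d \<in> cyls p"
proof (cases "c mod int p ^ n = a \<and> d mod int p ^ n = b")
  case True
  then have "cyl p n a b \<inter> cyl p m c d = cyl p m c d"
    using Zp_coherent[OF _ assms] by (auto simp: cyl_def Zp2_def)
  then show ?thesis by auto
next
  case False
  then have "cyl p n a b \<inter> cyl p m c d = cyl p 0 1 1"
    using Zp_coherent[OF _ assms] cyl_empty[of 1 p 0 1] by (auto simp: cyl_def Zp2_def)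
  then show ?thesis by auto
qed

lemma Int_stable_cyls: "Int_stable (cyls p)"
proof (rule Int_stableI)
  fix A B assume "A \<in> cyls p" "B \<in> cyls p"
  then obtain n a b m c d where "A = cyl p n a b" "B = cyl p m c d"
    by (auto simp: cyls_def)
  then show "A \<inter> B \<in> cyls p"
    using cyl_inter[of n m p a b c d] cyl_inter[of m n p c d a b]
    by (cases "n \<le> m") (auto simp: Int_commute)
qed

lemma open_coordinate_ball: "open {x :: nat \<Rightarrow> int. x n = a}"
proof -
  have "open {x :: nat \<Rightarrow> int. \<forall>i\<in>{n}. x i \<in> {a}}"
    by (rule product_topology_basis'[where x = id, simplified]) (auto simp: discrete_topology_class.open_discrete)
  then show ?thesis by simp
qed

lemma cyl_nbhd_1:
  assumes "open (U :: (nat \<Rightarrow> int) set)" "x \<in> U" "x \<in> carrier (Zp p)"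
  shows "\<exists>n. \<forall>m\<ge>n. \<forall>y\<in>carrier (Zp p). y m = x m \<longrightarrow> y \<in> U"
proof -
  obtain X where X: "x \<in> (\<Pi>\<^sub>E i\<in>UNIV. X i)" "finite {i. X i \<noteq> (UNIV :: int set)}"
    "(\<Pi>\<^sub>E i\<in>UNIV. X i) \<subseteq> U"
    using product_topology_open_contains_basis[of "\<lambda>_. euclidean" UNIV U x] assms
    by (auto simp: open_fun_def)
  obtain n where n: "\<And>i. X i \<noteq> UNIV \<Longrightarrow> i \<le> n"
    using X(2) by (auto simp: finite_nat_set_iff_bounded_le)
  have "y \<in> U" if "m \<ge> n" "y \<in> carrier (Zp p)" "y m = x m" for y m
  proof -
    have "y i \<in> X i" for i
    proof (cases "X i = UNIV")
      case False
      then have "i \<le> m" using n that by force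
      then have "y i = x i"
        using Zp_coherent that assms by metis
      then show ?thesis using X by auto
    qed auto
    then show ?thesis using X by (auto simp: PiE_UNIV_domain)
  qed
  then show ?thesis by blast
qed

lemma sets_borel_Zp2: "sets (restrict_space borel (Zp2 p)) = sigma_sets (Zp2 p) (cyls p)"
proof
  have "Zp2 p \<inter> U \<in> sigma_sets (Zp2 p) (cyls p)" if "open U" for U
  proof -
    define S where "S = Zp2 p \<inter> U"
    have "\<exists>C\<in>cyls p. z \<in> C \<and> C \<subseteq> S" if z: "z \<in> S" for z
    proof -
      have "z \<in> U" using z by (simp add: S_def)
      then obtain V W where VW: "open V" "open W" "fst z \<in> V" "snd z \<in> W" "V \<times> W \<subseteq> U"
        using \<open>open U\<close> by (metis mem_Times_iff open_prod_elim)
      have zc: "fst z \<in> carrier (Zp p)" "snd z \<in> carrier (Zp p)"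
        using z by (auto simp: Zp2_def S_def)
      obtain n1 where n1: "\<And>m y. m \<ge> n1 \<Longrightarrow> y \<in> carrier (Zp p) \<Longrightarrow> y m = fst z m \<Longrightarrow> y \<in> V"
        using cyl_nbhd_1[OF VW(1) VW(3) zc(1)] by blast
      obtain n2 where n2: "\<And>m y. m \<ge> n2 \<Longrightarrow> y \<in> carrier (Zp p) \<Longrightarrow> y m = snd z m \<Longrightarrow> y \<in> W"
        using cyl_nbhd_1[OF VW(2) VW(4) zc(2)] by blast
      let ?n = "max n1 n2"
      have "cyl p ?n (fst z ?n) (snd z ?n) \<subseteq> S"
        using n1[of ?n] n2[of ?n] VW(5) by (auto simp: cyl_def Zp2_def S_def)
      moreover have "z \<in> cyl p ?n (fst z ?n) (snd z ?n)"
        using z by (auto simp: cyl_def S_def)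
      ultimately show ?thesis by blast
    qed
    then have "S = \<Union> {C \<in> cyls p. C \<subseteq> S}" by blast
    moreover have "\<Union> {C \<in> cyls p. C \<subseteq> S} \<in> sigma_sets (Zp2 p) (cyls p)"
      by (rule sigma_sets_UNION)
        (auto intro: countable_subset[OF _ countable_cyls[of p]] sigma_sets.Basic)
    ultimately show ?thesis by (metis S_def)
  qed
  note opens = this
  have "Zp2 p \<inter> X \<in> sigma_sets (Zp2 p) (cyls p)" if "X \<in> sigma_sets UNIV {S. open S}" for X
    using that
  proof (induction X rule: sigma_sets.induct)
    case (Basic X)
    then show ?case using opens by simp
  next
    case Empty
    show ?case by (simp add: sigma_sets.Empty)
  next
    case (Compl X)
    have "Zp2 p \<inter> (UNIV - X) = Zp2 p - Zp2 p \<inter> X" by blast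
    then show ?case using sigma_sets.Compl[OF Compl.IH] by simp
  next
    case (Union X)
    have "Zp2 p \<inter> (\<Union>i. X i) = (\<Union>i. Zp2 p \<inter> X i)" by blast
    then show ?case using sigma_sets.Union[OF Union.IH] by simp
  qed
  then show "sets (restrict_space borel (Zp2 p)) \<subseteq> sigma_sets (Zp2 p) (cyls p)"
    by (auto simp: sets_restrict_space sets_borel)
next
  have "cyls p \<subseteq> sets (restrict_space borel (Zp2 p))"
  proof
    fix C assume "C \<in> cyls p"
    then obtain n a b where C: "C = cyl p n a b" by (auto simp: cyls_def)
    have "open ({x :: nat \<Rightarrow> int. x n = a} \<times> {x :: nat \<Rightarrow> int. x n = b})"
      by (intro open_Times open_coordinate_ball)
    moreover have "C = Zp2 p \<inter> ({x. x n = a} \<times> {x. x n = b})"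
      by (auto simp: C cyl_def)
    ultimately show "C \<in> sets (restrict_space borel (Zp2 p))"
      by (auto simp: sets_restrict_space)
  qed
  then show "sigma_sets (Zp2 p) (cyls p) \<subseteq> sets (restrict_space borel (Zp2 p))"
    using sets.sigma_sets_subset[of "cyls p" "restrict_space borel (Zp2 p)"]
    by (simp add: space_restrict_space)
qed

lemma translate_Zp2_closed:
  assumes "p > 0" "t \<in> Zp2 p" "z \<in> Zp2 p"
  shows "translate_Zp2 p t z \<in> Zp2 p"
proof -
  interpret cring "Zp p" using assms by (rule_tac cring_Zp)
  show ?thesis using assms by (auto simp: translate_Zp2_def Zp2_def)
qed

lemma translate_vimage_cyl:
  assumes "p > 0" "t \<in> Zp2 p" "0 \<le> a" "a < int p ^ n" "0 \<le> b" "b < int p ^ n"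
  shows "translate_Zp2 p t -` cyl p n a b \<inter> Zp2 p
       = cyl p n ((a - fst t n) mod int p ^ n) ((b - snd t n) mod int p ^ n)"
proof -
  have *: "(u + x) mod int p ^ n = c \<longleftrightarrow> x = (c - u) mod int p ^ n"
    if "0 \<le> c" "c < int p ^ n" "0 \<le> x" "x < int p ^ n" for u x c :: int
  proof
    assume "(u + x) mod int p ^ n = c"
    then have "(c - u) mod int p ^ n = (u + x - u) mod int p ^ n"
      by (metis mod_diff_left_eq)
    then show "x = (c - u) mod int p ^ n" using that by simp
  next
    assume "x = (c - u) mod int p ^ n"
    then show "(u + x) mod int p ^ n = c"
      using that by (simp add: mod_add_right_eq)
  qed
  have add: "(x \<oplus>\<^bsub>Zp p\<^esub> y) n = (x n + y n) mod int p ^ n" for x y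
    by (simp add: Zp_def)
  have "translate_Zp2 p t z \<in> cyl p n a b
      \<longleftrightarrow> z \<in> cyl p n ((a - fst t n) mod int p ^ n) ((b - snd t n) mod int p ^ n)"
    if z: "z \<in> Zp2 p" for z
  proof -
    have zc: "fst z \<in> carrier (Zp p)" "snd z \<in> carrier (Zp p)"
      using z by (auto simp: Zp2_def)
    have "translate_Zp2 p t z \<in> cyl p n a b \<longleftrightarrow>
        (fst t n + fst z n) mod int p ^ n = a \<and> (snd t n + snd z n) mod int p ^ n = b"
      using translate_Zp2_closed[OF assms(1,2) z] by (simp add: cyl_def) (simp add: translate_Zp2_def add)
    also have "\<dots> \<longleftrightarrow> fst z n = (a - fst t n) mod int p ^ n \<and> snd z n = (b - snd t n) mod int p ^ n"
      using *[OF assms(3,4) Zp_carrierD(1,2)[OF zc(1)], of "fst t n"]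
        *[OF assms(5,6) Zp_carrierD(1,2)[OF zc(2)], of "snd t n"] by simp
    finally show ?thesis using z by (simp add: cyl_def)
  qed
  then show ?thesis by (auto simp: cyl_def)
qed

text \<open>Uniformly distributed independent digits give the Haar measure.\<close>

definition digit_sum :: "nat \<Rightarrow> (nat \<Rightarrow> int \<times> int) \<Rightarrow> (nat \<Rightarrow> int) \<times> (nat \<Rightarrow> int)" where
  "digit_sum p w = ((\<lambda>n. \<Sum>i<n. fst (w i) * int p ^ i), (\<lambda>n. \<Sum>i<n. snd (w i) * int p ^ i))"

lemma digit_bounds:
  assumes "\<And>i. 0 \<le> d i \<and> d i < int p"
  shows "0 \<le> (\<Sum>i<n. d i * int p ^ i)" "(\<Sum>i<n. d i * int p ^ i) < int p ^ n"
proof -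
  show "0 \<le> (\<Sum>i<n. d i * int p ^ i)"
    by (intro sum_nonneg) (simp add: assms)
  show "(\<Sum>i<n. d i * int p ^ i) < int p ^ n"
  proof (induction n)
    case (Suc n)
    have "d n * int p ^ n \<le> (int p - 1) * int p ^ n"
      using assms[of n] by (intro mult_right_mono) auto
    then show ?case using Suc by (simp add: algebra_simps)
  qed simp
qed

lemma digit_sum_carrier:
  assumes "\<And>i. 0 \<le> d i \<and> d i < int p"
  shows "(\<lambda>n. \<Sum>i<n. d i * int p ^ i) \<in> carrier (Zp p)"
  using digit_bounds[of d p, OF assms] by (simp add: Zp_def)

lemma digit_sum_eq_iff:
  assumes "\<And>i. 0 \<le> d i \<and> d i < int p" "0 \<le> a" "a < int p ^ n"
  shows "(\<Sum>i<n. d i * int p ^ i) = a \<longleftrightarrow> (\<forall>i<n. d i = (a div int p ^ i) mod int p)"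
  using assms(2,3)
proof (induction n arbitrary: a)
  case (Suc n)
  let ?s = "\<Sum>i<n. d i * int p ^ i"
  have p: "int p > 0" using assms(1)[of 0] by linarith
  have s: "0 \<le> ?s" "?s < int p ^ n" using digit_bounds[of d p, OF assms(1)] by auto
  have m: "0 \<le> a mod int p ^ n" "a mod int p ^ n < int p ^ n" using p by auto
  have dn: "a div int p ^ n < int p"
  proof (rule ccontr)
    assume "\<not> a div int p ^ n < int p"
    then have "int p * int p ^ n \<le> a div int p ^ n * int p ^ n"
      using p by (intro mult_right_mono) auto
    also have "\<dots> \<le> a"
      using m(1) div_mult_mod_eq[of a "int p ^ n"] by linarith
    finally show False using Suc.prems by simp
  qed
  have dn0: "0 \<le> a div int p ^ n"
    using Suc.prems p by (simp add: pos_imp_zdiv_nonneg_iff)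
  have "(\<Sum>i<Suc n. d i * int p ^ i) = a \<longleftrightarrow> ?s = a mod int p ^ n \<and> d n = a div int p ^ n"
  proof
    assume "(\<Sum>i<Suc n. d i * int p ^ i) = a"
    then have "a = ?s + d n * int p ^ n" by simp
    then show "?s = a mod int p ^ n \<and> d n = a div int p ^ n" using s p by simp
  next
    assume "?s = a mod int p ^ n \<and> d n = a div int p ^ n"
    then show "(\<Sum>i<Suc n. d i * int p ^ i) = a" by (simp add: mod_div_mult_eq)
  qed
  also have "\<dots> \<longleftrightarrow> (\<forall>i<n. d i = (a mod int p ^ n div int p ^ i) mod int p) \<and> d n = a div int p ^ n"
    using Suc.IH[OF m] by simp
  also have "(\<forall>i<n. d i = (a mod int p ^ n div int p ^ i) mod int p)
      \<longleftrightarrow> (\<forall>i<n. d i = (a div int p ^ i) mod int p)"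
  proof -
    have "(a mod int p ^ n div int p ^ i) mod int p = (a div int p ^ i) mod int p" if "i < n" for i
    proof -
      obtain k where k: "n = i + Suc k" using less_imp_Suc_add[OF \<open>i < n\<close>] by auto
      define q r where "q = a div int p ^ n" and "r = a mod int p ^ n"
      have "a = int p ^ n * q + r"
        by (simp add: q_def r_def)
      also have "int p ^ n = int p ^ i * (int p * int p ^ k)"
        by (simp add: k power_add)
      finally have "a = r + (int p * int p ^ k * q) * int p ^ i"
        by (simp only: ac_simps)
      then have "a div int p ^ i = (r + (int p * int p ^ k * q) * int p ^ i) div int p ^ i"
        by (rule arg_cong)
      also have "\<dots> = int p * int p ^ k * q + r div int p ^ i"
        by (rule div_mult_self1) (use p in simp)
      also have "\<dots> mod int p = (r div int p ^ i) mod int p"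
        by (simp only: mult.assoc mod_mult_self4)
      finally show ?thesis by (simp add: r_def)
    qed
    then show ?thesis by auto
  qed
  also have "d n = a div int p ^ n \<longleftrightarrow> d n = (a div int p ^ n) mod int p"
    using dn dn0 by simp
  finally show ?case unfolding less_Suc_eq by blast
qed simp

lemma ex_normalized_haar:
  assumes "p > 0"
  shows "\<exists>\<mu>. is_normalized_haar p \<mu>"
proof -
  define A where "A = {0..<int p} \<times> {0..<int p}"
  define T where "T = PiM (UNIV :: nat set) (\<lambda>_. uniform_count_measure A)"
  define N where "N = sigma (Zp2 p) (cyls p)"
  define \<mu> where "\<mu> = distr T N (digit_sum p)"
  have A: "finite A" "A \<noteq> {}" "card A = p ^ 2"
    using assms by (auto simp: A_def power2_eq_square)
  interpret P: product_prob_space "\<lambda>_. uniform_count_measure A" "UNIV :: nat set"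
    using A by (intro product_prob_spaceI prob_space_uniform_count_measure)
  have spT: "space T = UNIV \<rightarrow>\<^sub>E A"
    by (simp add: T_def space_PiM space_uniform_count_measure)
  have setsN: "sets N = sigma_sets (Zp2 p) (cyls p)" and spN: "space N = Zp2 p"
    using cyls_subset by (simp_all add: N_def)
  have dig: "0 \<le> fst (w i) \<and> fst (w i) < int p" "0 \<le> snd (w i) \<and> snd (w i) < int p"
    if "w \<in> space T" for w i
    using that by (auto simp: spT A_def PiE_UNIV_domain Pi_iff mem_Times_iff)
  have in_plane: "digit_sum p w \<in> Zp2 p" if "w \<in> space T" for w
    using dig[OF that] by (auto simp: digit_sum_def Zp2_def intro!: digit_sum_carrier)
  define e where "e a b i = ((a div int p ^ i) mod int p, (b div int p ^ i) mod int p)"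
    for a b :: int and i :: nat
  have pre: "digit_sum p -` cyl p n a b \<inter> space T
      = prod_emb UNIV (\<lambda>_. uniform_count_measure A) {..<n} (PiE {..<n} (\<lambda>i. {e a b i}))"
    if "0 \<le> a" "a < int p ^ n" "0 \<le> b" "b < int p ^ n" for n a b
  proof -
    have "digit_sum p w \<in> cyl p n a b \<longleftrightarrow> (\<forall>i<n. w i = e a b i)" if "w \<in> space T" for w
    proof -
      have "digit_sum p w \<in> cyl p n a b \<longleftrightarrow>
          (\<Sum>i<n. fst (w i) * int p ^ i) = a \<and> (\<Sum>i<n. snd (w i) * int p ^ i) = b"
        using in_plane[OF that] by (simp add: cyl_def digit_sum_def)
      also have "\<dots> \<longleftrightarrow> (\<forall>i<n. w i = e a b i)"
        using \<open>0 \<le> a\<close> \<open>a < int p ^ n\<close> \<open>0 \<le> b\<close> \<open>b < int p ^ n\<close> dig[OF that]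
        by (subst (1 2) digit_sum_eq_iff) (auto simp: e_def prod_eq_iff)
      finally show ?thesis .
    qed
    then have "w \<in> digit_sum p -` cyl p n a b \<inter> space T \<longleftrightarrow>
        w \<in> space T \<and> (\<forall>i<n. w i = e a b i)" for w by auto
    then show ?thesis
      by (simp add: prod_emb_def spT PiE_UNIV_domain space_uniform_count_measure
          restrict_PiE_iff set_eq_iff conj_commute Pi_iff Ball_def)
  qed
  have eA: "e a b i \<in> A" for a b i
    using assms by (auto simp: e_def A_def)
  have meas: "digit_sum p \<in> measurable T N"
    unfolding N_def
  proof (rule measurable_measure_of)
    show "cyls p \<subseteq> Pow (Zp2 p)" by (rule cyls_subset)
    show "digit_sum p \<in> space T \<rightarrow> Zp2 p" using in_plane by auto
    fix C assume "C \<in> cyls p"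
    then obtain n a b where C: "C = cyl p n a b" by (auto simp: cyls_def)
    show "digit_sum p -` C \<inter> space T \<in> sets T"
    proof (cases "0 \<le> a \<and> a < int p ^ n \<and> 0 \<le> b \<and> b < int p ^ n")
      case True
      then show ?thesis
        unfolding C T_def using eA
        by (subst pre[unfolded T_def]) (auto intro!: sets_PiM_I simp: sets_uniform_count_measure)
    next
      case False
      then show ?thesis by (simp add: C cyl_empty)
    qed
  qed
  have setsmu: "sets \<mu> = sigma_sets (Zp2 p) (cyls p)" and spmu: "space \<mu> = Zp2 p"
    by (simp_all add: \<mu>_def setsN spN)
  have em: "emeasure \<mu> (cyl p n a b) = ennreal (1 / real p ^ 2) ^ n"
    if "0 \<le> a" "a < int p ^ n" "0 \<le> b" "b < int p ^ n" for n a b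
  proof -
    have "emeasure \<mu> (cyl p n a b) = emeasure T (digit_sum p -` cyl p n a b \<inter> space T)"
      unfolding \<mu>_def by (rule emeasure_distr[OF meas]) (auto simp: setsN intro: sigma_sets.Basic)
    also have "\<dots> = (\<Prod>i<n. emeasure (uniform_count_measure A) {e a b i})"
      unfolding pre[OF that] unfolding T_def
      by (rule P.emeasure_PiM_emb) (auto simp: eA sets_uniform_count_measure)
    also have "\<dots> = ennreal (1 / real p ^ 2) ^ n"
      using eA A by (simp add: emeasure_uniform_count_measure)
    finally show ?thesis .
  qed
  have inv: "distr \<mu> \<mu> (translate_Zp2 p t) = \<mu>" and tm: "translate_Zp2 p t \<in> measurable \<mu> \<mu>"
    if t: "t \<in> Zp2 p" for t
  proof -
    have mu_eq: "sets \<mu> = sets (sigma (Zp2 p) (cyls p))" using setsN setsmu by (simp add: N_def)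
    have "translate_Zp2 p t \<in> measurable \<mu> (sigma (Zp2 p) (cyls p))"
    proof (rule measurable_measure_of)
      show "cyls p \<subseteq> Pow (Zp2 p)" by (rule cyls_subset)
      show "translate_Zp2 p t \<in> space \<mu> \<rightarrow> Zp2 p"
        using translate_Zp2_closed[OF assms t] by (auto simp: spmu)
      fix C assume "C \<in> cyls p"
      then obtain n a b where C: "C = cyl p n a b" by (auto simp: cyls_def)
      show "translate_Zp2 p t -` C \<inter> space \<mu> \<in> sets \<mu>"
      proof (cases "0 \<le> a \<and> a < int p ^ n \<and> 0 \<le> b \<and> b < int p ^ n")
        case True
        then show ?thesis
          unfolding C spmu setsmu
          by (subst translate_vimage_cyl[OF assms t]) (auto intro: sigma_sets.Basic)
      next
        case False
        then show ?thesis by (simp add: C cyl_empty)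
      qed
    qed
    then show tm: "translate_Zp2 p t \<in> measurable \<mu> \<mu>"
      using measurable_cong_sets[OF refl mu_eq] by blast
    show "distr \<mu> \<mu> (translate_Zp2 p t) = \<mu>"
    proof (rule measure_eqI_generator_eq[OF Int_stable_cyls cyls_subset])
      fix C assume "C \<in> cyls p"
      then obtain n a b where C: "C = cyl p n a b" by (auto simp: cyls_def)
      show "emeasure (distr \<mu> \<mu> (translate_Zp2 p t)) C = emeasure \<mu> C"
      proof (cases "0 \<le> a \<and> a < int p ^ n \<and> 0 \<le> b \<and> b < int p ^ n")
        case True
        have "emeasure (distr \<mu> \<mu> (translate_Zp2 p t)) C
            = emeasure \<mu> (translate_Zp2 p t -` C \<inter> Zp2 p)"
          using emeasure_distr[OF tm, of C] by (auto simp: C setsmu spmu intro: sigma_sets.Basic)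
        also have "\<dots> = emeasure \<mu> C"
          using True assms by (simp add: C translate_vimage_cyl[OF assms t] em)
        finally show ?thesis .
      next
        case False
        then show ?thesis by (simp add: C cyl_empty)
      qed
    next
      show "range (\<lambda>_. Zp2 p) \<subseteq> cyls p" using Zp2_eq_cyl by auto
      have "emeasure \<mu> (Zp2 p) = 1" using em[of 0 0 0] by (simp add: Zp2_eq_cyl)
      moreover have "translate_Zp2 p t -` Zp2 p \<inter> space \<mu> = Zp2 p"
        using translate_Zp2_closed[OF assms t] by (auto simp: spmu)
      moreover have "Zp2 p \<in> sets \<mu>" using sets.top[of \<mu>] by (simp add: spmu)
      ultimately show "emeasure (distr \<mu> \<mu> (translate_Zp2 p t)) (Zp2 p) \<noteq> \<infinity>"
        using emeasure_distr[OF tm, of "Zp2 p"] by simp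
    qed (simp_all add: setsmu)
  qed
  interpret R: cring "Zp p" using assms by (rule cring_Zp)
  have "emeasure \<mu> (translate_Zp2 p t ` S) = emeasure \<mu> S" if t: "t \<in> Zp2 p" and S: "S \<in> sets \<mu>" for t S
  proof -
    define u where "u = (\<ominus>\<^bsub>Zp p\<^esub> fst t, \<ominus>\<^bsub>Zp p\<^esub> snd t)"
    have u: "u \<in> Zp2 p" using t by (auto simp: u_def Zp2_def)
    have SZ: "S \<subseteq> Zp2 p" using sets.sets_into_space[OF S] by (simp add: spmu)
    have tu: "translate_Zp2 p t (translate_Zp2 p u z) = z"
      and ut: "translate_Zp2 p u (translate_Zp2 p t z) = z" if "z \<in> Zp2 p" for z
      using that t
      by (auto simp: translate_Zp2_def u_def Zp2_def R.r_neg2 R.r_neg1)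
    have "translate_Zp2 p t ` S = translate_Zp2 p u -` S \<inter> space \<mu>"
    proof (intro equalityI subsetI)
      fix z assume "z \<in> translate_Zp2 p t ` S"
      then show "z \<in> translate_Zp2 p u -` S \<inter> space \<mu>"
        using SZ ut translate_Zp2_closed[OF assms t] by (auto simp: spmu)
    next
      fix z assume z: "z \<in> translate_Zp2 p u -` S \<inter> space \<mu>"
      then have "z = translate_Zp2 p t (translate_Zp2 p u z)" by (simp add: tu spmu)
      then show "z \<in> translate_Zp2 p t ` S" using z by blast
    qed
    then have "emeasure \<mu> (translate_Zp2 p t ` S) = emeasure (distr \<mu> \<mu> (translate_Zp2 p u)) S"
      using emeasure_distr[OF tm[OF u] S] by simp
    then show ?thesis by (simp add: inv[OF u])
  qed
  moreover have "emeasure \<mu> (Zp2 p) = 1" using em[of 0 0 0] by (simp add: Zp2_eq_cyl)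
  ultimately have "is_normalized_haar p \<mu>"
    unfolding is_normalized_haar_def by (simp add: setsmu sets_borel_Zp2)
  then show ?thesis ..
qed

lemma haar_Zp2_normalized: "p > 0 \<Longrightarrow> is_normalized_haar p (haar_Zp2 p)"
  unfolding haar_Zp2_def by (rule someI_ex) (rule ex_normalized_haar)

section \<open>Elliptic curves over the rationals\<close>

text \<open>The pair \<open>(A, B)\<close> stands for \<open>y\<^sup>2 = x\<^sup>3 + A x + B\<close>. Every elliptic curve over the
  rationals is isomorphic to exactly one member of the following set, so its elements are the
  isomorphism classes.\<close>

definition elliptic_curves :: "(int \<times> int) set" where
  "elliptic_curves = {(A, B). 4 * A ^ 3 + 27 * B ^ 2 \<noteq> 0 \<and>
     \<not> (\<exists>p. prime p \<and> p ^ 4 dvd A \<and> p ^ 6 dvd B)}"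

definition invI :: "int \<times> int \<Rightarrow> int" where
  "invI E = - 3 * fst E"

definition invJ :: "int \<times> int \<Rightarrow> int" where
  "invJ E = - 27 * snd E"

definition height :: "int \<times> int \<Rightarrow> real" where
  "height E = max (\<bar>real_of_int (invI E)\<bar> ^ 3) (real_of_int (invJ E) ^ 2 / 4)"

definition count_height_less :: "(int \<times> int) set \<Rightarrow> real \<Rightarrow> nat" where
  "count_height_less F X = card {E \<in> F. height E < X}"

section \<open>Families defined by local conditions\<close>

definition padic_invariants :: "nat \<Rightarrow> int \<times> int \<Rightarrow> (nat \<Rightarrow> int) \<times> (nat \<Rightarrow> int)" where
  "padic_invariants p E = (of_int_Zp p (invI E), of_int_Zp p (invJ E))"

definition family :: "(nat \<Rightarrow> ((nat \<Rightarrow> int) \<times> (nat \<Rightarrow> int)) set) \<Rightarrow> (int \<times> int) set" where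
  "family C = {E \<in> elliptic_curves. \<forall>p. prime p \<longrightarrow> padic_invariants p E \<in> C p}"

text \<open>Arbitrary subsets of the p-adic planes are not local conditions in a useful sense: a set
  of curves that has density zero but is p-adically dense for every \<open>p\<close> can be cut out by one
  subset of the 2-adic plane, or by omitting one point from each of infinitely many p-adic planes,
  and everything below sees such a set only through its closures. As is usual for
  such families, the conditions therefore have boundaries of measure zero, and they are closed;
  closedness is only needed, and only required, at all sufficiently large primes. Requiring them
  to be closed just away from vanishing discriminant would define the same families, because
  members of a family have nonzero discriminant.\<close>

definition local_conditions :: "(nat \<Rightarrow> ((nat \<Rightarrow> int) \<times> (nat \<Rightarrow> int)) set) \<Rightarrow> bool" where
  "local_conditions C \<longleftrightarrow>
     (\<forall>p. prime p \<longrightarrow> C p \<subseteq> Zp2 p \<and> Zp2_top p frontier_of C p \<in> null_sets (haar_Zp2 p)) \<and>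
     (\<forall>\<^sub>F p in sequentially. prime p \<longrightarrow> closedin (Zp2_top p) (C p))"

definition defined_by_local_conditions :: "(int \<times> int) set \<Rightarrow> bool" where
  "defined_by_local_conditions F \<longleftrightarrow> (\<exists>C. local_conditions C \<and> F = family C)"

definition F_inv :: "nat \<Rightarrow> (int \<times> int) set \<Rightarrow> ((nat \<Rightarrow> int) \<times> (nat \<Rightarrow> int)) set" where
  "F_inv p F = Zp2_top p closure_of (padic_invariants p ` F)"

definition disc_Zp :: "nat \<Rightarrow> (nat \<Rightarrow> int) \<Rightarrow> (nat \<Rightarrow> int) \<Rightarrow> nat \<Rightarrow> int" where
  "disc_Zp p A B = of_int_Zp p 16 \<otimes>\<^bsub>Zp p\<^esub>
     (of_int_Zp p 4 \<otimes>\<^bsub>Zp p\<^esub> (A [^]\<^bsub>Zp p\<^esub> (3::nat)) \<oplus>\<^bsub>Zp p\<^esub>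
      of_int_Zp p 27 \<otimes>\<^bsub>Zp p\<^esub> (B [^]\<^bsub>Zp p\<^esub> (2::nat)))"

text \<open>The curves \<open>y\<^sup>2 = x\<^sup>3 - (I/3) x - J/27\<close> over the p-adic numbers with \<open>(I, J) \<in> F_inv p F\<close>, as pairs
  of coefficients \<open>(A, B) = (- I/3, - J/27)\<close>. These are p-adic integers also for \<open>p = 3\<close>,
  since \<open>F_inv p F\<close> lies in the closed set of all \<open>(- 3 A, - 27 B)\<close>.\<close>

definition local_curves :: "nat \<Rightarrow> (int \<times> int) set \<Rightarrow> ((nat \<Rightarrow> int) \<times> (nat \<Rightarrow> int)) set" where
  "local_curves p F = {(A, B). (A, B) \<in> Zp2 p \<and> disc_Zp p A B \<noteq> \<zero>\<^bsub>Zp p\<^esub> \<and>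
     (of_int_Zp p (- 3) \<otimes>\<^bsub>Zp p\<^esub> A, of_int_Zp p (- 27) \<otimes>\<^bsub>Zp p\<^esub> B) \<in> F_inv p F}"

definition acceptable_at :: "nat \<Rightarrow> (int \<times> int) set \<Rightarrow> bool" where
  "acceptable_at p F \<longleftrightarrow>
     {(A, B). (A, B) \<in> Zp2 p \<and> \<not> of_int_Zp p (int p ^ 2) divides\<^bsub>Zp p\<^esub> disc_Zp p A B}
       \<subseteq> local_curves p F"

definition acceptable :: "(int \<times> int) set \<Rightarrow> bool" where
  "acceptable F \<longleftrightarrow> (\<forall>\<^sub>F p in sequentially. prime p \<longrightarrow> acceptable_at p F)"

definition M_U1 :: "nat \<Rightarrow> (int \<times> int) set \<Rightarrow> real" where
  "M_U1 p F = measure (haar_Zp2 p) (F_inv p F)"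

definition R_plus :: "(real \<times> real) set" where
  "R_plus = {(I, J). max (\<bar>I\<bar> ^ 3) (J ^ 2 / 4) < 1 \<and> 4 * I ^ 3 - J ^ 2 > 0}"

definition R_minus :: "(real \<times> real) set" where
  "R_minus = {(I, J). max (\<bar>I\<bar> ^ 3) (J ^ 2 / 4) < 1 \<and> - (4 * I ^ 3 - J ^ 2) > 0}"

end

theory Submission
  imports
    Defs
    "HOL-Number_Theory.Cong"
    "HOL-Real_Asymp.Real_Asymp"
begin

text \<open>The family is in bijection with the integral points \<open>(I, J)\<close> with \<open>4 I\<^sup>3 \<noteq> J\<^sup>2\<close> that lie, for
  every prime \<open>p\<close>, in \<open>S p = C p \<inter> minimal_plane p\<close>, where the second factor is clopen and encodes
  minimality of the model. Since \<open>S p\<close> has a null boundary, it is sandwiched between finite unions of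
  residue classes of almost equal density, so by the Chinese remainder theorem finitely many conditions
  cut out points of the expected density. Acceptability forces \<open>S p\<close>, for large \<open>p\<close>, to contain all
  points at which \<open>p\<^sup>2\<close> does not divide \<open>4 I\<^sup>3 - J\<^sup>2\<close>, so the remaining conditions are violated only on the tail where
  \<open>p\<^sup>2\<close> divides a nonzero \<open>4 I\<^sup>3 - J\<^sup>2\<close> for some \<open>p > Y\<close>. This tail is \<open>O(X\<^bsup>5/6\<^esup> / Y) + o(X\<^bsup>5/6\<^esup>)\<close>:
  such a \<open>p\<close> is at most \<open>3 X\<^bsup>1/2\<^esup>\<close>, for given \<open>I\<close> prime to \<open>p\<close> there are two classes of \<open>J\<close> modulo
  \<open>p\<^sup>2\<close>, and the rounding errors sum to \<open>O(X\<^bsup>1/3\<^esup> \<pi>(3 X\<^bsup>1/2\<^esup>)) = o(X\<^bsup>5/6\<^esup>)\<close> because the primes have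
  density zero. Finally \<open>M_U1 p F\<close> is the content of \<open>S p\<close> unless some \<open>S q\<close> has content zero, in which
  case both products vanish.\<close>

section \<open>Cylinders and Haar measure\<close>

definition cells :: "nat \<Rightarrow> nat \<Rightarrow> (int \<times> int) set" where
  "cells p n = {0..<int p ^ n} \<times> {0..<int p ^ n}"

lemma finite_cells [simp]: "finite (cells p n)"
  by (simp add: cells_def)

lemma card_cells: "card (cells p n) = p ^ (2 * n)"
proof -
  have "card (cells p n) = p ^ n * p ^ n"
    by (simp add: cells_def nat_power_eq)
  then show ?thesis by (simp add: mult_2 power_add)
qed

abbreviation cyl_at :: "nat \<Rightarrow> nat \<Rightarrow> (nat \<Rightarrow> int) \<times> (nat \<Rightarrow> int) \<Rightarrow> ((nat \<Rightarrow> int) \<times> (nat \<Rightarrow> int)) set" where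
  "cyl_at p n z \<equiv> cyl p n (fst z n) (snd z n)"

lemma cyl_subset_Zp2: "cyl p n a b \<subseteq> Zp2 p"
  by (auto simp: cyl_def)

lemma in_cyl_at: "z \<in> Zp2 p \<Longrightarrow> z \<in> cyl_at p n z"
  by (simp add: cyl_def)

lemma residues_in_cells: "z \<in> Zp2 p \<Longrightarrow> (fst z n, snd z n) \<in> cells p n"
  by (auto simp: cells_def Zp2_def dest: Zp_carrierD(1,2)[of _ p n])

lemma cyl_at_eq: "z \<in> cyl p n a b \<Longrightarrow> cyl_at p n z = cyl p n a b"
  by (simp add: cyl_def)

lemma cyl_at_antimono:
  assumes "z \<in> Zp2 p" "n \<le> m"
  shows "cyl_at p m z \<subseteq> cyl_at p n z"
proof
  fix w assume "w \<in> cyl_at p m z"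
  then have w: "w \<in> Zp2 p" "fst w m = fst z m" "snd w m = snd z m" by (auto simp: cyl_def)
  have "fst v m mod int p ^ n = fst v n" "snd v m mod int p ^ n = snd v n" if "v \<in> Zp2 p" for v
    using that Zp_coherent[OF _ assms(2)] by (auto simp: Zp2_def)
  then show "w \<in> cyl_at p n z" using assms(1) w by (simp add: cyl_def) metis
qed

lemma disjoint_cyls: "disjoint_family_on (\<lambda>(a, b). cyl p n a b) Q"
  by (auto simp: disjoint_family_on_def cyl_def)

text \<open>Haar invariance is stated for images, while \<open>translate_vimage_cyl\<close> computes
  preimages; translation by the negative converts one into the other.\<close>

lemma cyl_eq_translate:
  assumes "p > 0" "(a, b) \<in> cells p n"
  shows "cyl p n a b = translate_Zp2 p (of_int_Zp p a, of_int_Zp p b) ` cyl p n 0 0"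
proof -
  interpret R: cring "Zp p" using assms by (intro cring_Zp)
  define t u where "t = (of_int_Zp p a, of_int_Zp p b)"
    and "u = (\<ominus>\<^bsub>Zp p\<^esub> of_int_Zp p a, \<ominus>\<^bsub>Zp p\<^esub> of_int_Zp p b)"
  have t: "t \<in> Zp2 p" and u: "u \<in> Zp2 p"
    using of_int_Zp_closed[OF assms(1)] by (auto simp: t_def u_def Zp2_def)
  have ab: "0 \<le> a" "a < int p ^ n" "0 \<le> b" "b < int p ^ n"
    using assms by (auto simp: cells_def)
  have vim: "translate_Zp2 p t -` cyl p n a b \<inter> Zp2 p = cyl p n 0 0"
    using translate_vimage_cyl[OF assms(1) t ab] ab by (simp add: t_def of_int_Zp_def)
  have tu: "translate_Zp2 p t (translate_Zp2 p u z) = z" if "z \<in> Zp2 p" for z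
    using that of_int_Zp_closed[OF assms(1)]
    by (auto simp: translate_Zp2_def u_def t_def Zp2_def R.r_neg2)
  show ?thesis unfolding t_def[symmetric]
  proof
    show "translate_Zp2 p t ` cyl p n 0 0 \<subseteq> cyl p n a b"
      using vim by blast
    show "cyl p n a b \<subseteq> translate_Zp2 p t ` cyl p n 0 0"
    proof
      fix z assume z: "z \<in> cyl p n a b"
      then have "z \<in> Zp2 p" using cyl_subset_Zp2 by blast
      then have "translate_Zp2 p u z \<in> cyl p n 0 0"
        using z tu translate_Zp2_closed[OF assms(1) u] by (subst vim[symmetric]) auto
      then show "z \<in> translate_Zp2 p t ` cyl p n 0 0"
        using tu[OF \<open>z \<in> Zp2 p\<close>] by (metis image_eqI)
    qed
  qed
qed

section \<open>Haar measure of cylinders and of their finite unions\<close>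

lemma sets_haar: "p > 0 \<Longrightarrow> sets (haar_Zp2 p) = sets (restrict_space borel (Zp2 p))"
  using haar_Zp2_normalized by (simp add: is_normalized_haar_def)

lemma space_haar: "p > 0 \<Longrightarrow> space (haar_Zp2 p) = Zp2 p"
  using sets_eq_imp_space_eq[OF sets_haar] by (simp add: space_restrict_space)

lemma prob_space_haar: "p > 0 \<Longrightarrow> prob_space (haar_Zp2 p)"
  using haar_Zp2_normalized[of p] space_haar[of p]
  by (intro prob_spaceI) (simp add: is_normalized_haar_def)

lemma cyl_sets [intro]: "p > 0 \<Longrightarrow> cyl p n a b \<in> sets (haar_Zp2 p)"
  by (auto simp: sets_haar sets_borel_Zp2 intro: sigma_sets.Basic)

lemma closed_Zp2_sets: "p > 0 \<Longrightarrow> closedin (Zp2_top p) K \<Longrightarrow> K \<in> sets (haar_Zp2 p)"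
  by (auto simp: sets_haar Zp2_top_def closedin_closed sets_restrict_space)

lemma UN_cells: "(\<Union>(a, b)\<in>cells p n. cyl p n a b) = Zp2 p"
  using residues_in_cells cyl_subset_Zp2 by (fastforce simp: cyl_def)

text \<open>The \<open>p^(2n)\<close> classes of level \<open>n\<close> partition the plane and are
  translates of one another, so they share the total mass 1 equally.\<close>

lemma measure_cyl:
  assumes "p > 0" "(a, b) \<in> cells p n"
  shows "measure (haar_Zp2 p) (cyl p n a b) = 1 / real p ^ (2 * n)"
proof -
  interpret prob_space "haar_Zp2 p" using assms by (intro prob_space_haar)
  have eq: "prob (cyl p n a b) = prob (cyl p n 0 0)" if "(a, b) \<in> cells p n" for a b
  proof -
    have "(of_int_Zp p a, of_int_Zp p b) \<in> Zp2 p"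
      using of_int_Zp_closed[OF assms(1)] by (auto simp: Zp2_def)
    then show ?thesis
      using haar_Zp2_normalized[OF assms(1)] cyl_sets[OF assms(1), of n 0 0]
      unfolding cyl_eq_translate[OF assms(1) that] is_normalized_haar_def
      by (auto simp: measure_def)
  qed
  have "1 = prob (\<Union>(a, b)\<in>cells p n. cyl p n a b)"
    using prob_space assms by (simp add: UN_cells space_haar)
  also have "\<dots> = (\<Sum>(a, b)\<in>cells p n. prob (cyl p n a b))"
    by (subst finite_measure_finite_Union)
      (use assms disjoint_cyls in \<open>auto simp: case_prod_unfold\<close>)
  also have "\<dots> = real (p ^ (2 * n)) * prob (cyl p n 0 0)"
    using eq by (simp add: case_prod_unfold card_cells cong: sum.cong)
  finally show ?thesis
    using eq[OF assms(2)] assms by (simp add: field_simps)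
qed

lemma measure_UN_cyls:
  assumes "p > 0" "Q \<subseteq> cells p n"
  shows "measure (haar_Zp2 p) (\<Union>(a, b)\<in>Q. cyl p n a b) = real (card Q) / real p ^ (2 * n)"
proof -
  interpret prob_space "haar_Zp2 p" using assms by (intro prob_space_haar)
  have fin: "finite Q" using finite_subset[OF assms(2)] by simp
  have "prob (\<Union>(a, b)\<in>Q. cyl p n a b) = (\<Sum>(a, b)\<in>Q. prob (cyl p n a b))"
    by (subst finite_measure_finite_Union)
      (use assms fin disjoint_cyls in \<open>auto simp: case_prod_unfold\<close>)
  also have "\<dots> = (\<Sum>(a, b)\<in>Q. 1 / real p ^ (2 * n))"
    using assms by (intro sum.cong) (auto simp: measure_cyl)
  finally show ?thesis by simp
qed

section \<open>Cylinders as a clopen base of the p-adic plane\<close>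

lemma openin_cyl: "openin (Zp2_top p) (cyl p n a b)"
proof -
  have "open ({x :: nat \<Rightarrow> int. x n = a} \<times> {x :: nat \<Rightarrow> int. x n = b})"
    by (intro open_Times open_coordinate_ball)
  moreover have "cyl p n a b = Zp2 p \<inter> ({x. x n = a} \<times> {x. x n = b})"
    by (auto simp: cyl_def)
  ultimately show ?thesis
    by (metis Zp2_top_def openin_open_Int)
qed

lemma topspace_Zp2_top [simp]: "topspace (Zp2_top p) = Zp2 p"
  by (simp add: Zp2_top_def)

lemma cyl_at_nbhd:
  assumes "openin (Zp2_top p) U" "z \<in> U"
  shows "\<exists>n. cyl_at p n z \<subseteq> U"
proof -
  obtain T where T: "open T" "U = Zp2 p \<inter> T"
    using assms by (auto simp: Zp2_top_def openin_open)
  then obtain V W where VW: "open V" "open W" "fst z \<in> V" "snd z \<in> W" "V \<times> W \<subseteq> T"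
    using assms by (metis mem_Times_iff open_prod_elim Int_iff)
  have zc: "fst z \<in> carrier (Zp p)" "snd z \<in> carrier (Zp p)"
    using T assms by (auto simp: Zp2_def)
  obtain n1 where n1: "\<And>m y. m \<ge> n1 \<Longrightarrow> y \<in> carrier (Zp p) \<Longrightarrow> y m = fst z m \<Longrightarrow> y \<in> V"
    using cyl_nbhd_1[OF VW(1) VW(3) zc(1)] by blast
  obtain n2 where n2: "\<And>m y. m \<ge> n2 \<Longrightarrow> y \<in> carrier (Zp p) \<Longrightarrow> y m = snd z m \<Longrightarrow> y \<in> W"
    using cyl_nbhd_1[OF VW(2) VW(4) zc(2)] by blast
  have "cyl_at p (max n1 n2) z \<subseteq> U"
    using n1[of "max n1 n2"] n2[of "max n1 n2"] VW(5) by (auto simp: cyl_def Zp2_def T)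
  then show ?thesis by blast
qed

text \<open>The cylinders around \<open>z\<close> form a neighbourhood base, so membership in a
  closure can be tested on residues, level by level.\<close>

lemma closure_of_Zp2_iff:
  "z \<in> Zp2_top p closure_of S \<longleftrightarrow> z \<in> Zp2 p \<and> (\<forall>n. cyl_at p n z \<inter> S \<noteq> {})"
proof (intro iffI conjI allI)
  assume z: "z \<in> Zp2_top p closure_of S"
  then show zZ: "z \<in> Zp2 p" by (simp add: in_closure_of)
  fix n
  have "\<exists>y. y \<in> S \<and> y \<in> cyl_at p n z"
    using z in_cyl_at[OF zZ, of n] openin_cyl[of p n "fst z n" "snd z n"]
    by (simp add: in_closure_of)
  then show "cyl_at p n z \<inter> S \<noteq> {}" by blast
next
  assume z: "z \<in> Zp2 p \<and> (\<forall>n. cyl_at p n z \<inter> S \<noteq> {})"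
  show "z \<in> Zp2_top p closure_of S"
    unfolding in_closure_of
  proof (intro conjI allI impI)
    fix T assume "z \<in> T \<and> openin (Zp2_top p) T"
    then obtain n where "cyl_at p n z \<subseteq> T" using cyl_at_nbhd by blast
    then show "\<exists>y. y \<in> S \<and> y \<in> T" using z by blast
  qed (use z in simp)
qed

lemma closedin_cyl: "closedin (Zp2_top p) (cyl p n a b)"
  unfolding closure_of_subset_eq[symmetric]
proof (intro conjI subsetI)
  fix z assume "z \<in> Zp2_top p closure_of cyl p n a b"
  then have "z \<in> Zp2 p" "cyl_at p n z \<inter> cyl p n a b \<noteq> {}"
    by (auto simp: closure_of_Zp2_iff)
  then show "z \<in> cyl p n a b" by (auto simp: cyl_def)
qed (auto simp: cyl_def)

section \<open>Jordan content\<close>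

text \<open>With \<open>inner_cells\<close>, the p-adic counterpart of outer and inner Jordan
  approximation by a grid of mesh \<open>p^(-n)\<close>.\<close>

definition outer_cells :: "nat \<Rightarrow> nat \<Rightarrow> ((nat \<Rightarrow> int) \<times> (nat \<Rightarrow> int)) set \<Rightarrow> (int \<times> int) set" where
  "outer_cells p n S = {(a, b) \<in> cells p n. cyl p n a b \<inter> S \<noteq> {}}"

definition inner_cells :: "nat \<Rightarrow> nat \<Rightarrow> ((nat \<Rightarrow> int) \<times> (nat \<Rightarrow> int)) set \<Rightarrow> (int \<times> int) set" where
  "inner_cells p n S = {(a, b) \<in> cells p n. cyl p n a b \<subseteq> S}"

text \<open>The closure is measured because a set with null boundary need not be Borel.\<close>

definition content_Zp2 :: "nat \<Rightarrow> ((nat \<Rightarrow> int) \<times> (nat \<Rightarrow> int)) set \<Rightarrow> real" where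
  "content_Zp2 p S = measure (haar_Zp2 p) (Zp2_top p closure_of S)"

lemma outer_cells_subset: "outer_cells p n S \<subseteq> cells p n"
  and inner_cells_subset: "inner_cells p n S \<subseteq> cells p n"
  by (auto simp: outer_cells_def inner_cells_def)

lemma of_int_pair_in_cyl:
  assumes "p > 0" "(a, b) \<in> cells p n"
  shows "(of_int_Zp p a, of_int_Zp p b) \<in> cyl p n a b"
  using assms of_int_Zp_closed by (auto simp: cyl_def Zp2_def of_int_Zp_def cells_def)

lemma inner_subset_outer: "p > 0 \<Longrightarrow> inner_cells p n S \<subseteq> outer_cells p n S"
  using of_int_pair_in_cyl[of p _ _ n] by (auto simp: outer_cells_def inner_cells_def)

lemma content_le_one: "p > 0 \<Longrightarrow> content_Zp2 p S \<le> 1"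
  unfolding content_Zp2_def using prob_space.prob_le_1[OF prob_space_haar] by blast

lemma content_nonneg: "0 \<le> content_Zp2 p S"
  by (simp add: content_Zp2_def)

lemma content_mono:
  assumes "p > 0" "Zp2_top p closure_of S \<subseteq> Zp2_top p closure_of T"
  shows "content_Zp2 p S \<le> content_Zp2 p T"
proof -
  interpret prob_space "haar_Zp2 p" using assms by (intro prob_space_haar)
  show ?thesis unfolding content_Zp2_def
    by (intro finite_measure_mono assms closed_Zp2_sets) auto
qed

lemma UN_cyls_sets:
  assumes "p > 0" "Q \<subseteq> cells p n"
  shows "(\<Union>(a, b)\<in>Q. cyl p n a b) \<in> sets (haar_Zp2 p)"
  using assms finite_subset[OF assms(2)] by (intro sets.finite_UN) auto

lemma content_le_outer:
  assumes "p > 0"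
  shows "content_Zp2 p S \<le> real (card (outer_cells p n S)) / real p ^ (2 * n)"
proof -
  interpret prob_space "haar_Zp2 p" using assms by (intro prob_space_haar)
  have "Zp2_top p closure_of S \<subseteq> (\<Union>(a, b)\<in>outer_cells p n S. cyl p n a b)"
  proof
    fix z assume "z \<in> Zp2_top p closure_of S"
    then have z: "z \<in> Zp2 p" "cyl_at p n z \<inter> S \<noteq> {}" by (auto simp: closure_of_Zp2_iff)
    then have "(fst z n, snd z n) \<in> outer_cells p n S"
      using residues_in_cells by (auto simp: outer_cells_def)
    then show "z \<in> (\<Union>(a, b)\<in>outer_cells p n S. cyl p n a b)"
      using in_cyl_at[OF z(1)] by blast
  qed
  then have "content_Zp2 p S \<le> prob (\<Union>(a, b)\<in>outer_cells p n S. cyl p n a b)"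
    unfolding content_Zp2_def
    by (intro finite_measure_mono UN_cyls_sets assms outer_cells_subset)
  then show ?thesis using measure_UN_cyls[OF assms outer_cells_subset] by simp
qed

text \<open>The hypothesis asks for the closure rather than \<open>S\<close> itself, so that
  cylinders in which \<open>S\<close> is merely dense also count. This is how sets controlled only
  at integral points are bounded from below.\<close>

lemma cells_le_content:
  assumes "p > 0" "Q \<subseteq> cells p n" "\<And>a b. (a, b) \<in> Q \<Longrightarrow> cyl p n a b \<subseteq> Zp2_top p closure_of S"
  shows "real (card Q) / real p ^ (2 * n) \<le> content_Zp2 p S"
proof -
  interpret prob_space "haar_Zp2 p" by (rule prob_space_haar[OF assms(1)])
  have "(\<Union>(a, b)\<in>Q. cyl p n a b) \<subseteq> Zp2_top p closure_of S"
    using assms(3) by blast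
  then have "prob (\<Union>(a, b)\<in>Q. cyl p n a b) \<le> content_Zp2 p S"
    unfolding content_Zp2_def
    by (intro finite_measure_mono closed_Zp2_sets[OF assms(1)] closedin_closure_of)
  then show ?thesis using measure_UN_cyls[OF assms(1,2)] by simp
qed

lemma inner_le_content:
  assumes "p > 0" "S \<subseteq> Zp2 p"
  shows "real (card (inner_cells p n S)) / real p ^ (2 * n) \<le> content_Zp2 p S"
proof (rule cells_le_content[OF assms(1) inner_cells_subset])
  fix a b assume "(a, b) \<in> inner_cells p n S"
  then show "cyl p n a b \<subseteq> Zp2_top p closure_of S"
    using closure_of_subset[of S "Zp2_top p"] assms(2) by (auto simp: inner_cells_def)
qed

text \<open>The cells that meet \<open>S\<close> without lying in it cover sets that decrease with
  \<open>n\<close>. By the description of closures through cylinders, the intersection of these sets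
  is the frontier, and continuity from above of the Haar measure gives the limit.\<close>

lemma inner_outer_gap:
  assumes "p > 0" "S \<subseteq> Zp2 p" "Zp2_top p frontier_of S \<in> null_sets (haar_Zp2 p)"
  shows "(\<lambda>n. real (card (outer_cells p n S - inner_cells p n S)) / real p ^ (2 * n)) \<longlonglongrightarrow> 0"
proof -
  interpret prob_space "haar_Zp2 p" using assms by (intro prob_space_haar)
  define A where "A n = (\<Union>(a, b)\<in>outer_cells p n S - inner_cells p n S. cyl p n a b)" for n
  have sub: "outer_cells p n S - inner_cells p n S \<subseteq> cells p n" for n
    using outer_cells_subset[of p n S] by blast
  have A_iff: "z \<in> A n \<longleftrightarrow> z \<in> Zp2 p \<and> cyl_at p n z \<inter> S \<noteq> {} \<and> cyl_at p n z \<inter> (Zp2 p - S) \<noteq> {}" for z n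
  proof
    assume "z \<in> A n"
    then obtain a b where ab: "(a, b) \<in> outer_cells p n S - inner_cells p n S" "z \<in> cyl p n a b"
      by (auto simp: A_def)
    then have "cyl_at p n z = cyl p n a b" by (simp add: cyl_at_eq)
    then show "z \<in> Zp2 p \<and> cyl_at p n z \<inter> S \<noteq> {} \<and> cyl_at p n z \<inter> (Zp2 p - S) \<noteq> {}"
      using ab cyl_subset_Zp2[of p n a b] by (auto simp: outer_cells_def inner_cells_def)
  next
    assume z: "z \<in> Zp2 p \<and> cyl_at p n z \<inter> S \<noteq> {} \<and> cyl_at p n z \<inter> (Zp2 p - S) \<noteq> {}"
    then have "(fst z n, snd z n) \<in> outer_cells p n S - inner_cells p n S"
      using residues_in_cells[of z p n] by (auto simp: outer_cells_def inner_cells_def)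
    moreover have "z \<in> cyl_at p n z" using z by (simp add: in_cyl_at)
    ultimately show "z \<in> A n" unfolding A_def by blast
  qed
  have "decseq A"
  proof (rule antimonoI, rule subsetI)
    fix n m z assume "n \<le> m" "z \<in> A m"
    then show "z \<in> A n" using cyl_at_antimono[of z p n m] unfolding A_iff by blast
  qed
  moreover have "range A \<subseteq> sets (haar_Zp2 p)"
    using UN_cyls_sets[OF assms(1) sub] by (auto simp: A_def)
  ultimately have "(\<lambda>n. prob (A n)) \<longlonglongrightarrow> prob (\<Inter>n. A n)"
    by (rule finite_Lim_measure_decseq[rotated])
  moreover have "(\<Inter>n. A n) = Zp2_top p frontier_of S"
    using assms(2) by (auto simp: frontier_of_closures closure_of_Zp2_iff A_iff Int_absorb1)
  ultimately have "(\<lambda>n. prob (A n)) \<longlonglongrightarrow> 0"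
    using assms(3) by (simp add: measure_eq_0_null_sets)
  then show ?thesis using measure_UN_cyls[OF assms(1) sub] by (simp add: A_def)
qed

text \<open>The content lies between the inner and the outer cell densities for every
  \<open>n\<close>, so a level where these differ by less than \<open>e\<close> serves both
  inequalities.\<close>

lemma content_approx:
  assumes "p > 0" "S \<subseteq> Zp2 p" "Zp2_top p frontier_of S \<in> null_sets (haar_Zp2 p)" "e > 0"
  shows "\<exists>n. real (card (outer_cells p n S)) / real p ^ (2 * n) < content_Zp2 p S + e \<and>
             content_Zp2 p S - e < real (card (inner_cells p n S)) / real p ^ (2 * n)"
proof -
  obtain n where n: "real (card (outer_cells p n S - inner_cells p n S)) / real p ^ (2 * n) < e"
    using eventually_happens'[OF sequentially_bot
        order_tendstoD(2)[OF inner_outer_gap[OF assms(1-3)] assms(4)]] ..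
  have fin: "finite (inner_cells p n S)" "finite (outer_cells p n S)"
    by (rule finite_subset[OF inner_cells_subset finite_cells]
        finite_subset[OF outer_cells_subset finite_cells])+
  have "card (outer_cells p n S - inner_cells p n S) = card (outer_cells p n S) - card (inner_cells p n S)"
    by (rule card_Diff_subset[OF fin(1) inner_subset_outer[OF assms(1)]])
  moreover have "card (inner_cells p n S) \<le> card (outer_cells p n S)"
    by (rule card_mono[OF fin(2) inner_subset_outer[OF assms(1)]])
  ultimately have "real (card (outer_cells p n S)) / real p ^ (2 * n)
      - real (card (inner_cells p n S)) / real p ^ (2 * n) < e"
    using n by (simp add: of_nat_diff diff_divide_distrib)
  then show ?thesis
    using content_le_outer[OF assms(1), of S n] inner_le_content[OF assms(1,2), of n]
    by (intro exI[of _ n]) linarith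
qed

section \<open>Densities of sets of integral points\<close>

text \<open>The same maximum as in \<open>height\<close>, but as a function of the invariants, so
  that curves can be counted as lattice points.\<close>

definition ht :: "int \<times> int \<Rightarrow> real" where
  "ht z = max (\<bar>real_of_int (fst z)\<bar> ^ 3) (real_of_int (snd z) ^ 2 / 4)"

text \<open>The normalization is by \<open>X^(5/6)\<close> alone and not by the number of points in
  the height region, so the full plane of integral points has density 8.\<close>

definition has_density :: "(int \<times> int) set \<Rightarrow> real \<Rightarrow> bool" where
  "has_density S d \<longleftrightarrow> ((\<lambda>X. real (card {z \<in> S. ht z < X}) / X powr (5/6)) \<longlongrightarrow> d) at_top"

text \<open>The height region is a box with sides \<open>2 X^(1/3)\<close> and
  \<open>4 X^(1/2)\<close>, hence of area \<open>8 X^(5/6)\<close>; counting in it splits into two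
  one-dimensional counts.\<close>

lemma ht_less_iff:
  assumes "X > 0"
  shows "ht z < X \<longleftrightarrow> \<bar>real_of_int (fst z)\<bar> < X powr (1/3) \<and> \<bar>real_of_int (snd z)\<bar> < 2 * sqrt X"
proof -
  have "X = (X powr (1/3)) ^ 3"
    using assms by (simp add: powr_powr flip: powr_realpow)
  then have "\<bar>real_of_int (fst z)\<bar> ^ 3 < X \<longleftrightarrow> \<bar>real_of_int (fst z)\<bar> < X powr (1/3)"
    using power_mono_iff[of "X powr (1/3)" "\<bar>real_of_int (fst z)\<bar>" 3] by (simp add: not_le[symmetric])
  moreover have "real_of_int (snd z) ^ 2 / 4 < X \<longleftrightarrow> real_of_int (snd z) ^ 2 < (2 * sqrt X) ^ 2"
    using assms by (auto simp: power_mult_distrib)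
  moreover have "real_of_int (snd z) ^ 2 < (2 * sqrt X) ^ 2 \<longleftrightarrow> \<bar>real_of_int (snd z)\<bar> < 2 * sqrt X"
    using power_mono_iff[of "2 * sqrt X" "\<bar>real_of_int (snd z)\<bar>" 2] assms
    by (simp add: not_le[symmetric])
  ultimately show ?thesis by (simp add: ht_def)
qed

lemma finite_ht: "finite {z. ht z < X}"
proof (cases "X > 0")
  case True
  define k where "k = max \<lceil>X powr (1/3)\<rceil> \<lceil>2 * sqrt X\<rceil>"
  have "{z. ht z < X} \<subseteq> {-k..k} \<times> {-k..k}"
  proof
    fix z assume "z \<in> {z. ht z < X}"
    then have "\<bar>real_of_int (fst z)\<bar> < X powr (1/3)" "\<bar>real_of_int (snd z)\<bar> < 2 * sqrt X"
      using ht_less_iff[OF True] by auto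
    then have "\<bar>fst z\<bar> \<le> k" "\<bar>snd z\<bar> \<le> k"
      unfolding k_def by linarith+
    then show "z \<in> {-k..k} \<times> {-k..k}" by (auto simp: mem_Times_iff abs_le_iff)
  qed
  then show ?thesis by (rule finite_subset) simp
next
  case False
  have "\<not> ht z < X" for z
    using False zero_le_power[of "\<bar>real_of_int (fst z)\<bar>" 3] unfolding ht_def by linarith
  then have "{z. ht z < X} = {}" by blast
  then show ?thesis by (simp only: finite.emptyI)
qed

lemma finite_ht' [simp]: "finite {z \<in> S. ht z < X}"
  by (rule finite_subset[OF _ finite_ht]) auto

lemma has_density_unique: "has_density S d \<Longrightarrow> has_density S d' \<Longrightarrow> d = d'"
  unfolding has_density_def by (rule tendsto_unique) auto

lemma has_density_empty: "has_density {} 0"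
  by (simp add: has_density_def)

lemma has_density_UN:
  assumes "finite Q" "disjoint_family_on A Q" "\<And>x. x \<in> Q \<Longrightarrow> has_density (A x) (d x)"
  shows "has_density (\<Union>x\<in>Q. A x) (\<Sum>x\<in>Q. d x)"
proof -
  have "card {z \<in> \<Union>x\<in>Q. A x. ht z < X} = (\<Sum>x\<in>Q. card {z \<in> A x. ht z < X})" for X
  proof -
    have "{z \<in> \<Union>x\<in>Q. A x. ht z < X} = (\<Union>x\<in>Q. {z \<in> A x. ht z < X})" by auto
    moreover have "{z \<in> A x. ht z < X} \<inter> {z \<in> A y. ht z < X} = {}" if "x \<in> Q" "y \<in> Q" "x \<noteq> y" for x y
      using disjoint_family_onD[OF assms(2) that] by auto
    ultimately show ?thesis using assms(1) by (simp add: card_UN_disjoint)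
  qed
  moreover have "((\<lambda>X. \<Sum>x\<in>Q. real (card {z \<in> A x. ht z < X}) / X powr (5/6)) \<longlongrightarrow> (\<Sum>x\<in>Q. d x)) at_top"
    using assms(3) by (intro tendsto_sum) (simp add: has_density_def)
  ultimately show ?thesis by (simp add: has_density_def sum_divide_distrib)
qed

text \<open>Unions of inner and outer cells bracket a set with null boundary; this turns such a
  bracketing at every precision into a density.\<close>

lemma has_density_sandwich:
  assumes "\<And>e. e > 0 \<Longrightarrow> \<exists>A B a b. A \<subseteq> S \<and> S \<subseteq> B \<and> has_density A a \<and> has_density B b \<and> d - e < a \<and> b < d + e"
  shows "has_density S d"
  unfolding has_density_def
proof (rule tendstoI)
  fix e :: real assume "e > 0"
  then obtain A B a b where AB: "A \<subseteq> S" "S \<subseteq> B" and dens: "has_density A a" "has_density B b"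
    and ab: "d - e < a" "b < d + e"
    using assms[of e] by auto
  have "\<forall>\<^sub>F X in at_top. d - e < real (card {z \<in> A. ht z < X}) / X powr (5/6)"
    using order_tendstoD(1)[OF dens(1)[unfolded has_density_def] ab(1)] .
  moreover have "\<forall>\<^sub>F X in at_top. real (card {z \<in> B. ht z < X}) / X powr (5/6) < d + e"
    using order_tendstoD(2)[OF dens(2)[unfolded has_density_def] ab(2)] .
  ultimately show "\<forall>\<^sub>F X in at_top. dist (real (card {z \<in> S. ht z < X}) / X powr (5/6)) d < e"
  proof eventually_elim
    case (elim X)
    have "card {z \<in> A. ht z < X} \<le> card {z \<in> S. ht z < X}" "card {z \<in> S. ht z < X} \<le> card {z \<in> B. ht z < X}"
      using AB by (intro card_mono; auto)+
    then have "real (card {z \<in> A. ht z < X}) / X powr (5/6) \<le> real (card {z \<in> S. ht z < X}) / X powr (5/6)"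
      "real (card {z \<in> S. ht z < X}) / X powr (5/6) \<le> real (card {z \<in> B. ht z < X}) / X powr (5/6)"
      by (intro divide_right_mono; simp)+
    then show ?case using elim unfolding dist_real_def by linarith
  qed
qed

text \<open>Writing \<open>k = r + M t\<close> turns the count into that of the integers strictly
  between two reals at distance \<open>2 R / M\<close>, which differs from this distance by at most
  1.\<close>

lemma card_residue_interval:
  fixes M r :: int and R :: real
  assumes "0 \<le> r" "r < M" "R > 0"
  defines "N \<equiv> card {k. k mod M = r \<and> \<bar>real_of_int k\<bar> < R}"
  shows "2 * R / M - 1 \<le> real N" "real N \<le> 2 * R / M + 1"
proof -
  have M: "M > 0" using assms by linarith
  define u v where "u = (- R - r) / M" and "v = (R - r) / M"
  have uv: "v - u = 2 * R / M" by (simp add: u_def v_def flip: diff_divide_distrib)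
  have "{k. k mod M = r \<and> \<bar>real_of_int k\<bar> < R} = (\<lambda>t. r + M * t) ` {\<lfloor>u\<rfloor><..<\<lceil>v\<rceil>}" (is "?L = ?R")
  proof
    show "?L \<subseteq> ?R"
    proof
      fix k assume "k \<in> ?L"
      then have k: "k mod M = r" "\<bar>real_of_int k\<bar> < R" by auto
      have eq: "k = r + M * (k div M)" using k(1) by (metis add.commute mult_div_mod_eq)
      then have "real_of_int k = real_of_int r + real_of_int M * real_of_int (k div M)"
        by (metis of_int_add of_int_mult)
      then have "u < real_of_int (k div M)" "real_of_int (k div M) < v"
        using k(2) M by (auto simp: u_def v_def field_simps abs_less_iff)
      then have "k div M \<in> {\<lfloor>u\<rfloor><..<\<lceil>v\<rceil>}" by (simp add: floor_less_iff less_ceiling_iff)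
      then show "k \<in> ?R" using eq by blast
    qed
    show "?R \<subseteq> ?L"
    proof
      fix k assume "k \<in> ?R"
      then obtain t where "k = r + M * t" "t \<in> {\<lfloor>u\<rfloor><..<\<lceil>v\<rceil>}" by blast
      then have t: "k = r + M * t" "u < real_of_int t" "real_of_int t < v"
        by (simp_all add: floor_less_iff less_ceiling_iff)
      then have "\<bar>real_of_int k\<bar> < R" using M by (auto simp: u_def v_def field_simps abs_less_iff)
      then show "k \<in> ?L" using t assms by simp
    qed
  qed
  moreover have "inj_on (\<lambda>t. r + M * t) {\<lfloor>u\<rfloor><..<\<lceil>v\<rceil>}" using M by (auto simp: inj_on_def)
  ultimately have "N = card {\<lfloor>u\<rfloor><..<\<lceil>v\<rceil>}" unfolding N_def by (simp add: card_image)
  then have N: "N = nat (\<lceil>v\<rceil> - (\<lfloor>u\<rfloor> + 1))" by simp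
  have "u \<le> v" using uv M assms by (smt (verit) divide_nonneg_pos of_int_0_less_iff)
  then show "2 * R / M - 1 \<le> real N" "real N \<le> 2 * R / M + 1"
    unfolding uv[symmetric] N by linarith+
qed

text \<open>In the box of \<open>ht_less_iff\<close> the two congruences are independent, and each
  contributes its side length divided by \<open>M\<close>, up to an error of at most 1. The sides
  supply the factors 2 and 4 of the constant 8.\<close>

lemma has_density_residue_class:
  fixes M a b :: int
  assumes "0 \<le> a" "a < M" "0 \<le> b" "b < M"
  shows "has_density {(i, j). i mod M = a \<and> j mod M = b} (8 / real_of_int M ^ 2)"
proof -
  define f where "f r R = real (card {k. k mod M = r \<and> \<bar>real_of_int k\<bar> < R})" for r and R :: real
  have M: "real_of_int M > 0" using assms by simp
  have prod: "real (card {z \<in> {(i, j). i mod M = a \<and> j mod M = b}. ht z < X}) / X powr (5/6)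
      = (f a (X powr (1/3)) / X powr (1/3)) * (f b (2 * sqrt X) / sqrt X)" if "X > 0" for X
  proof -
    have "{z \<in> {(i, j). i mod M = a \<and> j mod M = b}. ht z < X}
        = {k. k mod M = a \<and> \<bar>real_of_int k\<bar> < X powr (1/3)} \<times> {k. k mod M = b \<and> \<bar>real_of_int k\<bar> < 2 * sqrt X}"
      using ht_less_iff[OF that] by auto
    moreover have "X powr (5/6) = X powr (1/3) * sqrt X"
      using that by (simp add: powr_half_sqrt[symmetric] flip: powr_add)
    ultimately show ?thesis by (simp add: f_def card_cartesian_product)
  qed
  have "((\<lambda>X. f a (X powr (1/3)) / X powr (1/3)) \<longlongrightarrow> 2 / M) at_top"
  proof (rule tendsto_sandwich)
    show "((\<lambda>X::real. 2 / M - 1 / X powr (1/3)) \<longlongrightarrow> 2 / M) at_top"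
      "((\<lambda>X::real. 2 / M + 1 / X powr (1/3)) \<longlongrightarrow> 2 / M) at_top" by real_asymp+
    show "\<forall>\<^sub>F X in at_top. 2 / M - 1 / X powr (1/3) \<le> f a (X powr (1/3)) / X powr (1/3)"
      using eventually_gt_at_top[of 0]
    proof eventually_elim
      case (elim X)
      then have "(2 * (X powr (1/3)) / M - 1) / (X powr (1/3)) \<le> (f a (X powr (1/3))) / (X powr (1/3))"
        using card_residue_interval(1)[OF assms(1,2), of "X powr (1/3)"] M
        unfolding f_def by (intro divide_right_mono) auto
      then show ?case using elim by (simp add: diff_divide_distrib)
    qed
    show "\<forall>\<^sub>F X in at_top. f a (X powr (1/3)) / X powr (1/3) \<le> 2 / M + 1 / X powr (1/3)"
      using eventually_gt_at_top[of 0]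
    proof eventually_elim
      case (elim X)
      then have "(f a (X powr (1/3))) / (X powr (1/3)) \<le> (2 * (X powr (1/3)) / M + 1) / (X powr (1/3))"
        using card_residue_interval(2)[OF assms(1,2), of "X powr (1/3)"] M
        unfolding f_def by (intro divide_right_mono) auto
      then show ?case using elim by (simp add: add_divide_distrib)
    qed
  qed
  moreover have "((\<lambda>X. f b (2 * sqrt X) / sqrt X) \<longlongrightarrow> 4 / M) at_top"
  proof (rule tendsto_sandwich)
    show "((\<lambda>X::real. 4 / M - 1 / sqrt X) \<longlongrightarrow> 4 / M) at_top"
      "((\<lambda>X::real. 4 / M + 1 / sqrt X) \<longlongrightarrow> 4 / M) at_top" by real_asymp+
    show "\<forall>\<^sub>F X in at_top. 4 / M - 1 / sqrt X \<le> f b (2 * sqrt X) / sqrt X"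
      using eventually_gt_at_top[of 0]
    proof eventually_elim
      case (elim X)
      then have "(2 * (2 * sqrt X) / M - 1) / (sqrt X) \<le> (f b (2 * sqrt X)) / (sqrt X)"
        using card_residue_interval(1)[OF assms(3,4), of "2 * sqrt X"] M
        unfolding f_def by (intro divide_right_mono) auto
      then show ?case using elim by (simp add: diff_divide_distrib)
    qed
    show "\<forall>\<^sub>F X in at_top. f b (2 * sqrt X) / sqrt X \<le> 4 / M + 1 / sqrt X"
      using eventually_gt_at_top[of 0]
    proof eventually_elim
      case (elim X)
      then have "(f b (2 * sqrt X)) / (sqrt X) \<le> (2 * (2 * sqrt X) / M + 1) / (sqrt X)"
        using card_residue_interval(2)[OF assms(3,4), of "2 * sqrt X"] M
        unfolding f_def by (intro divide_right_mono) auto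
      then show ?case using elim by (simp add: add_divide_distrib)
    qed
  qed
  ultimately have "((\<lambda>X. (f a (X powr (1/3)) / X powr (1/3)) * (f b (2 * sqrt X) / sqrt X))
      \<longlongrightarrow> (2 / M) * (4 / M)) at_top" by (rule tendsto_mult)
  then have "((\<lambda>X. real (card {z \<in> {(i, j). i mod M = a \<and> j mod M = b}. ht z < X}) / X powr (5/6))
      \<longlongrightarrow> (2 / M) * (4 / M)) at_top"
    by (rule Lim_transform_eventually)
      (use eventually_gt_at_top[of 0] in \<open>eventually_elim, simp only: prod\<close>)
  then show ?thesis unfolding has_density_def by (simp add: power2_eq_square)
qed

section \<open>Local conditions at finitely many primes\<close>

definition emb :: "nat \<Rightarrow> int \<times> int \<Rightarrow> (nat \<Rightarrow> int) \<times> (nat \<Rightarrow> int)" where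
  "emb p z = (of_int_Zp p (fst z), of_int_Zp p (snd z))"

lemma emb_Zp2: "p > 0 \<Longrightarrow> emb p z \<in> Zp2 p"
  by (simp add: emb_def Zp2_def of_int_Zp_closed)

lemma emb_in_cyl_iff:
  "p > 0 \<Longrightarrow> emb p z \<in> cyl p n a b \<longleftrightarrow> fst z mod int p ^ n = a \<and> snd z mod int p ^ n = b"
  using emb_Zp2[of p z] by (auto simp: cyl_def emb_def of_int_Zp_def)

text \<open>One \<open>r\<close> has to serve all \<open>i\<close> at once: in this form a residue
  class modulo a prime power can be absorbed into the modulus.\<close>

lemma crt_residue_iff:
  fixes M K a c :: int
  assumes "coprime M K" "0 \<le> a" "a < M" "0 \<le> c" "c < K"
  shows "\<exists>r. 0 \<le> r \<and> r < M * K \<and> (\<forall>i. i mod M = a \<and> i mod K = c \<longleftrightarrow> i mod (M * K) = r)"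
proof -
  obtain x where x: "[x = a] (mod M)" "[x = c] (mod K)"
    using binary_chinese_remainder_int[OF assms(1)] by blast
  have "i mod M = a \<and> i mod K = c \<longleftrightarrow> i mod (M * K) = x mod (M * K)" for i
  proof -
    have "i mod M = a \<and> i mod K = c \<longleftrightarrow> [i = x] (mod M) \<and> [i = x] (mod K)"
      using x assms by (simp add: cong_def)
    also have "\<dots> \<longleftrightarrow> [i = x] (mod (M * K))"
      using coprime_cong_mult[OF _ _ assms(1)] cong_modulus_mult[of i x M K] cong_modulus_mult[of i x K M]
      by (auto simp: mult.commute)
    finally show ?thesis by (simp add: cong_def)
  qed
  moreover have "M * K > 0" using assms by simp
  ultimately show ?thesis by (intro exI[of _ "x mod (M * K)"]) auto
qed

text \<open>Induction on the set of primes with the congruence modulo \<open>M\<close> generalized.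
  A class modulo \<open>q^n\<close> at a new prime \<open>q\<close> merges with the class modulo
  \<open>M\<close> by the Chinese remainder theorem, and the induction hypothesis applies to the
  modulus \<open>M q^n\<close>. The condition at \<open>q\<close> is bracketed by unions of such
  classes.\<close>

theorem has_density_local_conditions:
  fixes S :: "nat \<Rightarrow> ((nat \<Rightarrow> int) \<times> (nat \<Rightarrow> int)) set"
  assumes "finite T" "\<And>p. p \<in> T \<Longrightarrow> prime p"
    "\<And>p. p \<in> T \<Longrightarrow> S p \<subseteq> Zp2 p"
    "\<And>p. p \<in> T \<Longrightarrow> Zp2_top p frontier_of S p \<in> null_sets (haar_Zp2 p)"
    "\<And>p. p \<in> T \<Longrightarrow> coprime M (int p)" "0 \<le> a" "a < M" "0 \<le> b" "b < M"
  shows "has_density {z. fst z mod M = a \<and> snd z mod M = b \<and> (\<forall>p\<in>T. emb p z \<in> S p)}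
    (8 / real_of_int M ^ 2 * (\<Prod>p\<in>T. content_Zp2 p (S p)))"
  using assms
proof (induction T arbitrary: M a b)
  case empty
  then show ?case using has_density_residue_class[of a M b] by (simp add: case_prod_unfold)
next
  case (insert q T)
  let ?P = "\<Prod>p\<in>T. content_Zp2 p (S p)"
  define D where "D M a b T = {z. fst z mod M = a \<and> snd z mod M = b \<and> (\<forall>p\<in>T. emb p z \<in> S p)}"
    for M a b and T :: "nat set"
  have q: "prime q" "q > 0" using insert.prems(1)[of q] prime_gt_0_nat by auto
  have P0: "?P \<ge> 0" by (intro prod_nonneg) (simp add: content_nonneg)
  have M: "M > 0" using insert.prems by linarith
  have cell: "has_density {z \<in> D M a b T. (fst z mod int q ^ n, snd z mod int q ^ n) = x}
      (8 / real_of_int M ^ 2 * ?P / real q ^ (2 * n))" if x: "x \<in> cells q n" for n x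
  proof -
    obtain c d where cd: "x = (c, d)" "0 \<le> c" "c < int q ^ n" "0 \<le> d" "d < int q ^ n"
      using x by (auto simp: cells_def)
    have cop: "coprime M (int q ^ n)" using insert.prems(4)[of q] by simp
    obtain r where r: "0 \<le> r" "r < M * int q ^ n" "\<And>i. i mod M = a \<and> i mod int q ^ n = c \<longleftrightarrow> i mod (M * int q ^ n) = r"
      using crt_residue_iff[OF cop insert.prems(5,6) cd(2,3)] by auto
    obtain s where s: "0 \<le> s" "s < M * int q ^ n" "\<And>i. i mod M = b \<and> i mod int q ^ n = d \<longleftrightarrow> i mod (M * int q ^ n) = s"
      using crt_residue_iff[OF cop insert.prems(7,8) cd(4,5)] by auto
    have "coprime (M * int q ^ n) (int p)" if p: "p \<in> T" for p
    proof -
      have "coprime q p" using p insert.prems(1)[of p] q insert.hyps(2) by (auto intro!: primes_coprime)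
      then show ?thesis using insert.prems(4)[of p] p by simp
    qed
    then have "has_density (D (M * int q ^ n) r s T) (8 / real_of_int (M * int q ^ n) ^ 2 * ?P)"
      unfolding D_def using r s insert.prems(1,2,3) by (intro insert.IH) auto
    moreover have "D (M * int q ^ n) r s T = {z \<in> D M a b T. (fst z mod int q ^ n, snd z mod int q ^ n) = x}"
      using r(3) s(3) by (auto simp: D_def cd)
    moreover have "8 / real_of_int (M * int q ^ n) ^ 2 * ?P = 8 / real_of_int M ^ 2 * ?P / real q ^ (2 * n)"
      by (simp add: power_mult_distrib power_even_eq divide_divide_eq_left)
    ultimately show ?thesis by (simp only:)
  qed
  have cellsQ: "has_density {z \<in> D M a b T. (fst z mod int q ^ n, snd z mod int q ^ n) \<in> Q}
      (8 / real_of_int M ^ 2 * ?P * (real (card Q) / real q ^ (2 * n)))" if Q: "Q \<subseteq> cells q n" for n Q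
  proof -
    have "has_density (\<Union>x\<in>Q. {z \<in> D M a b T. (fst z mod int q ^ n, snd z mod int q ^ n) = x})
        (\<Sum>x\<in>Q. 8 / real_of_int M ^ 2 * ?P / real q ^ (2 * n))"
      using finite_subset[OF Q finite_cells] cell Q
      by (intro has_density_UN) (auto simp: disjoint_family_on_def)
    moreover have "(\<Union>x\<in>Q. {z \<in> D M a b T. (fst z mod int q ^ n, snd z mod int q ^ n) = x})
        = {z \<in> D M a b T. (fst z mod int q ^ n, snd z mod int q ^ n) \<in> Q}" by auto
    ultimately show ?thesis by (simp add: mult_ac)
  qed
  define c where "c = 8 / real_of_int M ^ 2 * ?P"
  have c0: "c \<ge> 0" using P0 by (simp add: c_def)
  have "has_density (D M a b (insert q T)) (c * content_Zp2 q (S q))"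
  proof (rule has_density_sandwich)
    fix e :: real assume "e > 0"
    \<comment> \<open>Adding 1 keeps the denominator positive when \<open>c = 0\<close> and still
      gives \<open>c * e' < e\<close>.\<close>
    define e' where "e' = e / (c + 1)"
    have e': "e' > 0" using \<open>e > 0\<close> c0 by (simp add: e'_def)
    obtain n where n: "real (card (outer_cells q n (S q))) / real q ^ (2 * n) < content_Zp2 q (S q) + e'"
      "content_Zp2 q (S q) - e' < real (card (inner_cells q n (S q))) / real q ^ (2 * n)"
      using content_approx[OF q(2) insert.prems(2)[of q] insert.prems(3)[of q] e'] by auto
    let ?B = "\<lambda>Q. {z \<in> D M a b T. (fst z mod int q ^ n, snd z mod int q ^ n) \<in> Q}"
    have in_cells: "(fst z mod int q ^ n, snd z mod int q ^ n) \<in> cells q n" for z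
      using q by (simp add: cells_def)
    have in_cyl: "emb q z \<in> cyl q n (fst z mod int q ^ n) (snd z mod int q ^ n)" for z
      using q by (simp add: emb_in_cyl_iff)
    have "?B (inner_cells q n (S q)) \<subseteq> D M a b (insert q T)"
      using in_cyl by (auto simp: D_def inner_cells_def)
    moreover have "D M a b (insert q T) \<subseteq> ?B (outer_cells q n (S q))"
    proof
      fix z assume z: "z \<in> D M a b (insert q T)"
      then have "emb q z \<in> cyl q n (fst z mod int q ^ n) (snd z mod int q ^ n) \<inter> S q"
        using in_cyl[of z] by (simp add: D_def)
      then show "z \<in> ?B (outer_cells q n (S q))"
        using in_cells[of z] z by (auto simp: D_def outer_cells_def)
    qed
    moreover have "c * content_Zp2 q (S q) - e < c * (real (card (inner_cells q n (S q))) / real q ^ (2 * n))"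
      "c * (real (card (outer_cells q n (S q))) / real q ^ (2 * n)) < c * content_Zp2 q (S q) + e"
    proof -
      have lt: "c * e' < e"
        using \<open>e > 0\<close> c0 by (simp add: e'_def pos_divide_less_eq algebra_simps)
      have "c * (content_Zp2 q (S q) - e') \<le> c * (real (card (inner_cells q n (S q))) / real q ^ (2 * n))"
        using n by (intro mult_left_mono c0) simp
      then show "c * content_Zp2 q (S q) - e < c * (real (card (inner_cells q n (S q))) / real q ^ (2 * n))"
        using lt unfolding right_diff_distrib by linarith
      have "c * (real (card (outer_cells q n (S q))) / real q ^ (2 * n)) \<le> c * (content_Zp2 q (S q) + e')"
        using n by (intro mult_left_mono c0) simp
      then show "c * (real (card (outer_cells q n (S q))) / real q ^ (2 * n)) < c * content_Zp2 q (S q) + e"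
        using lt unfolding distrib_left by linarith
    qed
    ultimately show "\<exists>A B a' b'. A \<subseteq> D M a b (insert q T) \<and> D M a b (insert q T) \<subseteq> B \<and> has_density A a' \<and> has_density B b'
        \<and> c * content_Zp2 q (S q) - e < a' \<and> b' < c * content_Zp2 q (S q) + e"
      using cellsQ[OF inner_cells_subset, of n "S q", folded c_def] cellsQ[OF outer_cells_subset, of n "S q", folded c_def]
      by blast
  qed
  then show ?case using insert.hyps by (simp add: D_def c_def mult_ac)
qed

section \<open>Primes have density zero\<close>

lemma prod_primes_dvd:
  fixes m :: nat
  assumes "finite A" "\<And>p. p \<in> A \<Longrightarrow> prime p \<and> p dvd m"
  shows "\<Prod>A dvd m"
  using assms
proof (induction A rule: finite_induct)
  case (insert q A)
  have "coprime q (\<Prod>A)"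
    using insert by (intro prod_coprime_right) (auto intro!: primes_coprime)
  then show ?case using insert by (simp add: divides_mult)
qed simp

text \<open>Erdos' argument: for \<open>n = 2 m + 1\<close> the primes in the interval from
  \<open>m + 2\<close> to \<open>n\<close> all divide the binomial coefficient
  \<open>n choose m\<close>, which is at most \<open>4^m\<close>; an even \<open>n > 2\<close> is
  not prime, so \<open>n - 1\<close> gives the same product.\<close>

lemma primorial_le: "\<Prod>{p::nat. prime p \<and> p \<le> n} \<le> 4 ^ n"
proof (induction n rule: less_induct)
  case (less n)
  show ?case
  proof (cases "even n")
    case True
    show ?thesis
    proof (cases "n \<le> 2")
      case True
      have "{p::nat. prime p \<and> p \<le> n} \<subseteq> {2}"
      proof
        fix p assume "p \<in> {p::nat. prime p \<and> p \<le> n}"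
        then show "p \<in> {2}" using True prime_ge_2_nat[of p] by auto
      qed
      then have "{p::nat. prime p \<and> p \<le> n} = {} \<or> (n = 2 \<and> {p::nat. prime p \<and> p \<le> n} = {2})"
        using True by auto
      then show ?thesis
      proof
        assume "{p::nat. prime p \<and> p \<le> n} = {}"
        then show ?thesis by (simp only: prod.empty) simp
      next
        assume "n = 2 \<and> {p::nat. prime p \<and> p \<le> n} = {2}"
        then show ?thesis by (elim conjE) (simp only:, simp)
      qed
    next
      case False
      then have "\<not> prime n" using \<open>even n\<close> prime_odd_nat[of n] by auto
      then have "p \<le> n \<longleftrightarrow> p \<le> n - 1" if "prime p" for p
        using that by (cases "p = n") auto
      then have "{p::nat. prime p \<and> p \<le> n} = {p. prime p \<and> p \<le> n - 1}" by blast
      then have "\<Prod>{p::nat. prime p \<and> p \<le> n} \<le> 4 ^ (n - 1)"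
        using less.IH[of "n - 1"] False by simp
      also have "\<dots> \<le> 4 ^ n" by (intro power_increasing) auto
      finally show ?thesis .
    qed
  next
    case False
    then obtain m where m: "n = 2 * m + 1" by (elim oddE)
    show ?thesis
    \<comment> \<open>For \<open>m = 0\<close> the induction hypothesis at \<open>m + 1 = n\<close>
      would be circular.\<close>
    proof (cases "m = 0")
      case True
      then have "\<not> (prime p \<and> p \<le> n)" for p :: nat using m prime_ge_2_nat[of p] by auto
      then have "{p::nat. prime p \<and> p \<le> n} = {}" by blast
      then show ?thesis by (simp only: prod.empty) simp
    next
      case False
      define B where "B = {p::nat. prime p \<and> m + 1 < p \<and> p \<le> 2 * m + 1}"
      have "\<Prod>B dvd (2 * m + 1) choose m"
      proof (rule prod_primes_dvd)
        show "finite B" by (rule finite_subset[of _ "{..2 * m + 1}"]) (auto simp: B_def)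
        fix p assume "p \<in> B"
        then have p: "prime p" "m + 1 < p" "p \<le> 2 * m + 1" by (auto simp: B_def)
        have "fact m * fact (m + 1) * ((2 * m + 1) choose m) = (fact (2 * m + 1) :: nat)"
          using binomial_fact_lemma[of m "2 * m + 1"] by simp
        moreover have "p dvd fact (2 * m + 1)" using p by (simp only: prime_dvd_fact_iff)
        ultimately have "p dvd fact m * fact (m + 1) * ((2 * m + 1) choose m)" by (simp only:)
        moreover have "\<not> p dvd fact m" "\<not> p dvd fact (m + 1)"
          using p by (simp_all only: prime_dvd_fact_iff)
        ultimately show "prime p \<and> p dvd (2 * m + 1) choose m"
          using p(1) by (metis prime_dvd_mult_iff)
      qed
      then have "\<Prod>B \<le> (2 * m + 1) choose m" by (intro dvd_imp_le) auto
      \<comment> \<open>By symmetry the entries with \<open>k \<le> m\<close> make up half of the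
        sum \<open>2^(2 m + 1)\<close> of the row.\<close>
      also have "\<dots> \<le> (\<Sum>k\<le>m. (2 * m + 1) choose k)" by (rule member_le_sum) auto
      also have "\<dots> = 4 ^ m" by (simp only: binomial_r_part_sum power_mult) simp
      finally have B: "\<Prod>B \<le> 4 ^ m" .
      have "{p::nat. prime p \<and> p \<le> n} = {p. prime p \<and> p \<le> m + 1} \<union> B"
        using m False by (auto simp: B_def)
      then have "\<Prod>{p::nat. prime p \<and> p \<le> n} = \<Prod>{p. prime p \<and> p \<le> m + 1} * \<Prod>B"
        by (simp only:) (rule prod.union_disjoint, auto simp: B_def)
      also have "\<dots> \<le> 4 ^ (m + 1) * 4 ^ m"
        using False m by (intro mult_mono less.IH B) auto
      also have "\<dots> = 4 ^ n" unfolding m by (simp only: mult_2 flip: power_add) simp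
      finally show ?thesis .
    qed
  qed
qed

lemma finite_primes_le [simp]: "finite {p::nat. prime p \<and> real p \<le> x}"
  by (rule finite_subset[of _ "{..nat \<lfloor>x\<rfloor>}"]) (auto simp: le_nat_floor)

text \<open>Chebyshev's argument: each prime in \<open>B\<close> contributes a factor above
  \<open>sqrt x\<close> to the primorial, so \<open>primorial_le\<close> bounds their number, while
  the primes up to \<open>sqrt x\<close> are few by the trivial bound.\<close>

lemma card_primes_le:
  assumes "x \<ge> 4"
  shows "real (card {p::nat. prime p \<and> real p \<le> x}) \<le> sqrt x + x * ln 4 / ln (sqrt x)"
proof -
  define A B where "A = {p::nat. prime p \<and> real p \<le> sqrt x}"
    and "B = {p::nat. prime p \<and> sqrt x < real p \<and> real p \<le> x}"
  have s: "sqrt x > 1" using assms by (simp add: real_less_rsqrt)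
  have finB: "finite B" by (rule finite_subset[OF _ finite_primes_le[of x]]) (auto simp: B_def)
  have "A \<subseteq> {1..nat \<lfloor>sqrt x\<rfloor>}" by (auto simp: A_def le_nat_floor Suc_le_eq prime_gt_0_nat)
  then have "card A \<le> nat \<lfloor>sqrt x\<rfloor>" using card_mono[of "{1..nat \<lfloor>sqrt x\<rfloor>}" A] by simp
  then have A: "real (card A) \<le> sqrt x" using s by linarith
  have "sqrt x ^ card B = (\<Prod>p\<in>B. sqrt x)" by simp
  also have "\<dots> \<le> (\<Prod>p\<in>B. real p)" using s by (intro prod_mono) (auto simp: B_def)
  also have "\<dots> = real (\<Prod>B)" by simp
  also have "\<Prod>B \<le> \<Prod>{p::nat. prime p \<and> p \<le> nat \<lfloor>x\<rfloor>}"
  proof (rule dvd_imp_le[OF prod_dvd_prod_subset])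
    show "B \<subseteq> {p::nat. prime p \<and> p \<le> nat \<lfloor>x\<rfloor>}" by (auto simp: B_def le_nat_floor)
    show "0 < \<Prod>{p::nat. prime p \<and> p \<le> nat \<lfloor>x\<rfloor>}"
      using prime_gt_0_nat by (intro prod_pos) auto
  qed simp
  also have "\<dots> \<le> 4 ^ nat \<lfloor>x\<rfloor>" by (rule primorial_le)
  finally have "sqrt x ^ card B \<le> 4 ^ nat \<lfloor>x\<rfloor>" by simp
  then have "ln (sqrt x ^ card B) \<le> ln (4 ^ nat \<lfloor>x\<rfloor>)" using s by (subst ln_le_cancel_iff) auto
  then have "real (card B) * ln (sqrt x) \<le> real (nat \<lfloor>x\<rfloor>) * ln 4"
    using s by (simp add: ln_realpow)
  also have "\<dots> \<le> x * ln 4" using assms by (intro mult_right_mono) auto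
  finally have B: "real (card B) \<le> x * ln 4 / ln (sqrt x)"
    using s by (simp add: field_simps)
  have "{p::nat. prime p \<and> real p \<le> x} \<subseteq> A \<union> B" by (auto simp: A_def B_def)
  then have "card {p::nat. prime p \<and> real p \<le> x} \<le> card (A \<union> B)"
    using finB by (intro card_mono) (auto simp: A_def)
  also have "\<dots> \<le> card A + card B" by (rule card_Un_le)
  finally show ?thesis using A B by linarith
qed

lemma primes_density_zero:
  "((\<lambda>x. real (card {p::nat. prime p \<and> real p \<le> x}) / x) \<longlongrightarrow> 0) at_top"
proof (rule tendsto_sandwich)
  show "((\<lambda>x::real. 0::real) \<longlongrightarrow> 0) at_top" by simp
  show "((\<lambda>x::real. (sqrt x + x * ln 4 / ln (sqrt x)) / x) \<longlongrightarrow> 0) at_top" by real_asymp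
  show "\<forall>\<^sub>F x::real in at_top. 0 \<le> real (card {p::nat. prime p \<and> real p \<le> x}) / x"
    using eventually_ge_at_top[of 0] by eventually_elim simp
  show "\<forall>\<^sub>F x::real in at_top. real (card {p::nat. prime p \<and> real p \<le> x}) / x
      \<le> (sqrt x + x * ln 4 / ln (sqrt x)) / x"
    using eventually_ge_at_top[of 4]
    by eventually_elim (intro divide_right_mono card_primes_le, auto)
qed

section \<open>The discriminant modulo squares of primes\<close>

text \<open>Two roots \<open>r\<close> and \<open>j\<close> make \<open>p^2\<close> divide
  \<open>(j - r) (j + r)\<close>. As \<open>p\<close> divides neither 2 nor \<open>r\<close>, it
  does not divide both factors, so \<open>p^2\<close> divides one of them. If there is no root at
  all, any \<open>r\<close> will do.\<close>

lemma square_roots_mod_prime_square: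
  fixes i :: int
  assumes "prime p" "p > 2" "\<not> int p dvd i"
  shows "\<exists>r. \<forall>j. int p ^ 2 dvd 4 * i ^ 3 - j ^ 2 \<longrightarrow>
    j mod int p ^ 2 = r mod int p ^ 2 \<or> j mod int p ^ 2 = (- r) mod int p ^ 2"
proof (cases "\<exists>r. int p ^ 2 dvd 4 * i ^ 3 - r ^ 2")
  case True
  then obtain r where r: "int p ^ 2 dvd 4 * i ^ 3 - r ^ 2" by blast
  have p: "prime (int p)" using assms by simp
  have p2: "\<not> int p dvd 2"
    using assms(2) by (auto dest!: zdvd_imp_le)
  have pr: "\<not> int p dvd r"
  proof
    assume "int p dvd r"
    then have "int p dvd r ^ 2" by (simp add: power2_eq_square)
    moreover have "int p dvd 4 * i ^ 3 - r ^ 2"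
      by (rule dvd_trans[OF _ r]) (simp add: power2_eq_square)
    ultimately have "int p dvd (4 * i ^ 3 - r ^ 2) + r ^ 2" by (intro dvd_add)
    then have "int p dvd 2 * 2 * i ^ 3" by simp
    then have "int p dvd i ^ 3" using p p2 by (simp only: prime_dvd_mult_iff) simp
    then show False using p assms(3) prime_dvd_power by blast
  qed
  have "j mod int p ^ 2 = r mod int p ^ 2 \<or> j mod int p ^ 2 = (- r) mod int p ^ 2"
    if j: "int p ^ 2 dvd 4 * i ^ 3 - j ^ 2" for j
  proof -
    have "int p ^ 2 dvd (4 * i ^ 3 - r ^ 2) - (4 * i ^ 3 - j ^ 2)" using r j by (rule dvd_diff)
    also have "(4 * i ^ 3 - r ^ 2) - (4 * i ^ 3 - j ^ 2) = (j - r) * (j + r)"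
      by (simp add: algebra_simps power2_eq_square)
    finally have d: "int p ^ 2 dvd (j - r) * (j + r)" .
    have "\<not> (int p dvd j - r \<and> int p dvd j + r)"
    proof
      assume "int p dvd j - r \<and> int p dvd j + r"
      then have "int p dvd (j + r) - (j - r)" by (elim conjE) (rule dvd_diff)
      then have "int p dvd 2 * r" by simp
      then show False using p p2 pr by (metis prime_dvd_mult_iff)
    qed
    then have "coprime (int p ^ 2) (j - r) \<or> coprime (int p ^ 2) (j + r)"
      using p by (auto intro: prime_imp_coprime)
    then have "int p ^ 2 dvd j + r \<or> int p ^ 2 dvd j - r"
      using d by (auto simp: coprime_dvd_mult_right_iff coprime_dvd_mult_left_iff)
    then show ?thesis
      by (auto simp: mod_eq_dvd_iff)
  qed
  then show ?thesis by blast
qed auto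

lemma prime_square_dvd_discriminant:
  fixes i j :: int
  assumes "prime p" "int p ^ 2 dvd 4 * i ^ 3 - j ^ 2" "int p dvd i"
  shows "int p dvd j"
proof -
  have "int p dvd 4 * i ^ 3 - j ^ 2"
    by (rule dvd_trans[OF _ assms(2)]) (simp add: power2_eq_square)
  moreover have "int p dvd 4 * i ^ 3" using assms(3) by (simp add: power3_eq_cube)
  ultimately have "int p dvd j ^ 2"
    using dvd_diff[of "int p" "4 * i ^ 3" "4 * i ^ 3 - j ^ 2"] by (simp del: dvd_diff)
  moreover have "prime (int p)" using assms(1) by simp
  ultimately show ?thesis using prime_dvd_power by blast
qed

lemma card_discriminant_roots:
  fixes i :: int and R :: real
  assumes "prime p" "p > 2" "\<not> int p dvd i" "R > 0"
  shows "real (card {j. \<bar>real_of_int j\<bar> < R \<and> int p ^ 2 dvd 4 * i ^ 3 - j ^ 2}) \<le> 2 * (2 * R / real p ^ 2 + 1)"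
proof -
  obtain r where r: "\<And>j. int p ^ 2 dvd 4 * i ^ 3 - j ^ 2 \<Longrightarrow>
      j mod int p ^ 2 = r mod int p ^ 2 \<or> j mod int p ^ 2 = (- r) mod int p ^ 2"
    using square_roots_mod_prime_square[OF assms(1-3)] by blast
  let ?N = "\<lambda>c. {k. k mod int p ^ 2 = c mod int p ^ 2 \<and> \<bar>real_of_int k\<bar> < R}"
  have fin: "finite (?N c)" for c
  proof (rule finite_subset)
    show "?N c \<subseteq> {-\<lceil>R\<rceil>..\<lceil>R\<rceil>}" by (auto simp: abs_less_iff) linarith+
  qed simp
  have p: "int p ^ 2 > 0" using assms by simp
  have N: "real (card (?N c)) \<le> 2 * R / real p ^ 2 + 1" for c
    using card_residue_interval(2)[of "c mod int p ^ 2" "int p ^ 2" R] p assms(4) by simp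
  have "card {j. \<bar>real_of_int j\<bar> < R \<and> int p ^ 2 dvd 4 * i ^ 3 - j ^ 2} \<le> card (?N r \<union> ?N (- r))"
    using r fin by (intro card_mono) auto
  also have "\<dots> \<le> card (?N r) + card (?N (- r))" by (rule card_Un_le)
  finally have "real (card {j. \<bar>real_of_int j\<bar> < R \<and> int p ^ 2 dvd 4 * i ^ 3 - j ^ 2})
      \<le> real (card (?N r)) + real (card (?N (- r)))"
    unfolding of_nat_add[symmetric] of_nat_le_iff .
  also have "\<dots> \<le> (2 * R / real p ^ 2 + 1) + (2 * R / real p ^ 2 + 1)"
    by (intro add_mono N)
  finally show ?thesis by (simp only: mult_2)
qed

text \<open>Comparison with the telescoping terms
  \<open>1 / (N (N + 1)) = 1 / N - 1 / (N + 1)\<close>.\<close>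

lemma sum_inverse_squares_le:
  assumes "finite P" "Y > 0" "\<And>p. p \<in> P \<Longrightarrow> Y < p"
  shows "(\<Sum>p\<in>P. 1 / real p ^ 2) \<le> 1 / real Y"
proof -
  have tele: "(\<Sum>p\<in>{Y<..N}. 1 / real p ^ 2) \<le> 1 / real Y - 1 / real N" if "Y \<le> N" for N
    using that
  proof (induction N rule: dec_induct)
    case (step N)
    have N: "real N > 0" using step \<open>Y > 0\<close> by simp
    then have "1 / real (Suc N) ^ 2 \<le> 1 / (real N * real (Suc N))"
      unfolding power2_eq_square by (intro divide_left_mono mult_right_mono mult_pos_pos) auto
    also have "\<dots> = 1 / real N - 1 / real (Suc N)" using N by (simp add: field_simps)
    finally have "1 / real (Suc N) ^ 2 \<le> 1 / real N - 1 / real (Suc N)" .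
    moreover have "{Y<..Suc N} = insert (Suc N) {Y<..N}" using step by auto
    ultimately show ?case using step by simp
  qed simp
  define N where "N = Max (insert Y P)"
  have "P \<subseteq> {Y<..N}"
  proof
    fix p assume "p \<in> P"
    then show "p \<in> {Y<..N}" using assms(3) Max_ge[of "insert Y P" p] assms(1) by (simp add: N_def)
  qed
  then have "(\<Sum>p\<in>P. 1 / real p ^ 2) \<le> (\<Sum>p\<in>{Y<..N}. 1 / real p ^ 2)"
    by (intro sum_mono2) auto
  also have "\<dots> \<le> 1 / real Y - 1 / real N"
    by (rule tele) (simp add: N_def assms(1))
  also have "\<dots> \<le> 1 / real Y" by simp
  finally show ?thesis .
qed

text \<open>Leaving out the multiple 0 compensates the rounding error 1, so the second bound is
  proportional to \<open>1 / p\<close>; in the tail estimate this yields a summable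
  \<open>1 / p^2\<close>.\<close>

lemma card_multiples_le:
  assumes "p > 0" "R > 0"
  shows "real (card {k::int. int p dvd k \<and> \<bar>real_of_int k\<bar> < R}) \<le> 2 * R / real p + 1"
    "real (card {k::int. k \<noteq> 0 \<and> int p dvd k \<and> \<bar>real_of_int k\<bar> < R}) \<le> 2 * R / real p"
proof -
  let ?N = "{k::int. int p dvd k \<and> \<bar>real_of_int k\<bar> < R}"
  show 1: "real (card ?N) \<le> 2 * R / real p + 1"
    using card_residue_interval(2)[of 0 "int p" R] assms by (simp add: dvd_eq_mod_eq_0)
  have fin: "finite ?N"
  proof (rule finite_subset)
    show "?N \<subseteq> {-\<lceil>R\<rceil>..\<lceil>R\<rceil>}" by (auto simp: abs_less_iff) linarith+
  qed simp
  have "{k::int. k \<noteq> 0 \<and> int p dvd k \<and> \<bar>real_of_int k\<bar> < R} = ?N - {0}" by auto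
  moreover have "card (?N - {0}) = card ?N - 1" using assms by (subst card_Diff_singleton) auto
  moreover have "card ?N > 0" using fin assms by (auto simp: card_gt_0_iff intro!: exI[of _ 0])
  ultimately show "real (card {k::int. k \<noteq> 0 \<and> int p dvd k \<and> \<bar>real_of_int k\<bar> < R}) \<le> 2 * R / real p"
    using 1 by simp
qed

section \<open>The tail of points whose discriminant is divisible by the square of a large
  prime\<close>

lemma finite_int_ball [simp]: "finite {k::int. \<bar>real_of_int k\<bar> < R}"
proof (rule finite_subset)
  show "{k::int. \<bar>real_of_int k\<bar> < R} \<subseteq> {-\<lceil>R\<rceil>..\<lceil>R\<rceil>}" by (auto simp: abs_less_iff) linarith+
qed simp

text \<open>Vanishing discriminants are left out because every \<open>p^2\<close> divides 0; they
  are counted separately.\<close>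

definition square_divisor_tail :: "nat \<Rightarrow> (int \<times> int) set" where
  "square_divisor_tail Y = {(i, j). 4 * i ^ 3 \<noteq> j ^ 2 \<and>
     (\<exists>p. prime p \<and> Y < p \<and> int p ^ 2 dvd 4 * i ^ 3 - j ^ 2)}"

text \<open>Three cases: the line \<open>i = 0\<close> (\<open>B0\<close>), on which all points are
  counted; \<open>p\<close> dividing \<open>i \<noteq> 0\<close> (\<open>B1\<close>), where
  \<open>p\<close> also divides \<open>j\<close> and \<open>p \<le> a\<close>; and \<open>p\<close>
  not dividing \<open>i\<close> (\<open>B2\<close>), where \<open>j\<close> is confined to two
  classes modulo \<open>p^2\<close> and \<open>p \<le> 3 s\<close>.\<close>

lemma tail_bound:
  assumes "Y \<ge> 2" "X \<ge> 1"
  defines "a \<equiv> X powr (1/3)" and "s \<equiv> sqrt X"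
  shows "real (card {z \<in> square_divisor_tail Y. ht z < X})
    \<le> 4 * s + 1 + 34 * a * s / real Y + 6 * a * real (card {p::nat. prime p \<and> real p \<le> 3 * s})"
proof -
  have a1: "a \<ge> 1" using assms by (simp add: a_def ge_one_powr_ge_zero)
  have "X powr (1/3) \<le> X powr (1/2)" using assms by (intro powr_mono) auto
  then have as: "a \<le> s" using assms by (simp only: a_def s_def powr_half_sqrt)
  have s1: "s \<ge> 1" using a1 as by linarith
  have a3: "a ^ 3 = X" using assms by (simp add: a_def powr_powr flip: powr_realpow)
  have s2: "s ^ 2 = X" using assms by (simp add: s_def)
  define P1 where "P1 = {p::nat. prime p \<and> Y < p \<and> real p \<le> a}"
  define P2 where "P2 = {p::nat. prime p \<and> Y < p \<and> real p \<le> 3 * s}"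
  define I where "I = {i::int. \<bar>real_of_int i\<bar> < a}"
  define B0 where "B0 = {0::int} \<times> {j::int. \<bar>real_of_int j\<bar> < 2 * s}"
  define B1 where "B1 p = {i::int. i \<noteq> 0 \<and> int p dvd i \<and> \<bar>real_of_int i\<bar> < a}
      \<times> {j::int. int p dvd j \<and> \<bar>real_of_int j\<bar> < 2 * s}" for p :: nat
  define B2 where "B2 i p = {i} \<times> {j::int. \<bar>real_of_int j\<bar> < 2 * s \<and> int p ^ 2 dvd 4 * i ^ 3 - j ^ 2 \<and> \<not> int p dvd i}"
    for p :: nat and i :: int
  have fin: "finite P1" "finite P2" "finite I"
    by (auto simp: P1_def P2_def I_def intro: finite_subset[OF _ finite_primes_le])
  have finJ: "finite {j::int. \<bar>real_of_int j\<bar> < R \<and> P j}" for R P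
    by (rule finite_subset[OF _ finite_int_ball[of R]]) auto
  have finJ': "finite {j::int. P j \<and> \<bar>real_of_int j\<bar> < R}" for R P
    by (rule finite_subset[OF _ finite_int_ball[of R]]) auto
  have finB: "finite B0" "finite (B1 p)" "finite (B2 i p)" for i p
    unfolding B0_def B1_def B2_def
    using finJ'[of "\<lambda>i. i \<noteq> 0 \<and> int p dvd i" a] finJ'[of "\<lambda>j. int p dvd j" "2 * s"] finJ[of "2 * s"]
    by (simp_all add: conj_assoc)
  have card0: "real (card B0) \<le> 4 * s + 1"
    using card_multiples_le(1)[of 1 "2 * s"] s1 by (simp add: B0_def card_cartesian_product)
  have card1: "real (card (B1 p)) \<le> 10 * a * s * (1 / real p ^ 2)" if "p \<in> P1" for p
  proof -
    have p: "p > 0" "real p \<le> a" using that by (auto simp: P1_def prime_gt_0_nat)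
    have "real (card (B1 p)) = real (card {i::int. i \<noteq> 0 \<and> int p dvd i \<and> \<bar>real_of_int i\<bar> < a})
        * real (card {j::int. int p dvd j \<and> \<bar>real_of_int j\<bar> < 2 * s})"
      by (simp add: B1_def card_cartesian_product)
    also have "\<dots> \<le> (2 * a / real p) * (2 * (2 * s) / real p + 1)"
      using card_multiples_le(2)[of p a] card_multiples_le(1)[of p "2 * s"] p a1 s1
      by (intro mult_mono) auto
    \<comment> \<open>Since \<open>p \<le> a \<le> s\<close>, the rounding term 1 is at most
      \<open>s / p\<close>.\<close>
    also have "\<dots> \<le> (2 * a / real p) * (5 * s / real p)"
      using p as a1 by (intro mult_left_mono) (auto simp: field_simps)
    finally show ?thesis by (simp add: power2_eq_square mult_ac)
  qed
  have card2: "real (card (B2 i p)) \<le> 8 * s * (1 / real p ^ 2) + 2" if "p \<in> P2" for i p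
  proof (cases "int p dvd i")
    case True
    then have "B2 i p = {}" by (auto simp: B2_def)
    then show ?thesis using s1 by simp
  next
    case False
    then have "card (B2 i p) = card {j::int. \<bar>real_of_int j\<bar> < 2 * s \<and> int p ^ 2 dvd 4 * i ^ 3 - j ^ 2}"
      by (simp add: B2_def card_cartesian_product)
    then show ?thesis
      using card_discriminant_roots[of p i "2 * s"] that assms s1 False by (auto simp: P2_def)
  qed
  have cover: "{z \<in> square_divisor_tail Y. ht z < X} \<subseteq> B0 \<union> (\<Union>p\<in>P1. B1 p) \<union> (\<Union>i\<in>I. \<Union>p\<in>P2. B2 i p)"
  proof
    fix z assume z: "z \<in> {z \<in> square_divisor_tail Y. ht z < X}"
    obtain i j where ij: "z = (i, j)" by (cases z)
    have ht: "\<bar>real_of_int i\<bar> < a" "\<bar>real_of_int j\<bar> < 2 * s"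
      using z ht_less_iff[of X z] assms by (auto simp: ij)
    obtain p where p: "prime p" "Y < p" "int p ^ 2 dvd 4 * i ^ 3 - j ^ 2" and ne: "4 * i ^ 3 \<noteq> j ^ 2"
      using z by (auto simp: ij square_divisor_tail_def)
    consider "i = 0" | "i \<noteq> 0" "int p dvd i" | "\<not> int p dvd i" by blast
    then show "z \<in> B0 \<union> (\<Union>p\<in>P1. B1 p) \<union> (\<Union>i\<in>I. \<Union>p\<in>P2. B2 i p)"
    proof cases
      case 1
      then have "z \<in> B0" using ht by (simp add: B0_def ij)
      then show ?thesis by blast
    next
      case 2
      have "int p dvd j" by (rule prime_square_dvd_discriminant[OF p(1,3) 2(2)])
      moreover have "int p \<le> \<bar>i\<bar>" using 2 dvd_imp_le_int by force
      then have "real p \<le> a" using ht(1) by linarith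
      ultimately have "z \<in> B1 p" "p \<in> P1" using 2 ht p by (auto simp: B1_def P1_def ij)
      then show ?thesis by blast
    next
      case 3
      \<comment> \<open>A nonzero multiple of \<open>p^2\<close> is at least \<open>p^2\<close> in
        absolute value, and the box bounds it by \<open>4 X + 4 X \<le> 9 X\<close>; this is the
        origin of \<open>3 s\<close>.\<close>
      have "int p ^ 2 \<le> \<bar>4 * i ^ 3 - j ^ 2\<bar>" using p(3) ne by (intro zdvd_imp_le) auto
      then have "real_of_int (int p ^ 2) \<le> real_of_int \<bar>4 * i ^ 3 - j ^ 2\<bar>"
        by (simp only: of_int_le_iff)
      also have "\<dots> \<le> 4 * \<bar>real_of_int i\<bar> ^ 3 + \<bar>real_of_int j\<bar> ^ 2"
        by (simp add: power_abs[symmetric]) (simp add: power_abs abs_triangle_ineq4[THEN order_trans] abs_mult)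
      also have "\<dots> \<le> 4 * a ^ 3 + (2 * s) ^ 2"
        using ht by (intro add_mono mult_left_mono power_mono) auto
      also have "\<dots> \<le> (3 * s) ^ 2" using a3 s2 assms by (simp add: power_mult_distrib)
      finally have "real p \<le> 3 * s" using s1 by (intro power2_le_imp_le[of "real p" "3 * s"]) auto
      then have "z \<in> B2 i p" "p \<in> P2" "i \<in> I" using 3 ht p by (auto simp: B2_def P2_def I_def ij)
      then show ?thesis by blast
    qed
  qed
  have "card {z \<in> square_divisor_tail Y. ht z < X} \<le> card (B0 \<union> (\<Union>p\<in>P1. B1 p) \<union> (\<Union>i\<in>I. \<Union>p\<in>P2. B2 i p))"
    using fin finB by (intro card_mono cover) auto
  also have "\<dots> \<le> card B0 + card (\<Union>p\<in>P1. B1 p) + card (\<Union>i\<in>I. \<Union>p\<in>P2. B2 i p)"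
    by (intro order_trans[OF card_Un_le] add_mono order_refl card_Un_le)
  also have "\<dots> \<le> card B0 + (\<Sum>p\<in>P1. card (B1 p)) + (\<Sum>i\<in>I. \<Sum>p\<in>P2. card (B2 i p))"
    by (intro add_mono order_refl card_UN_le[OF fin(1)] order_trans[OF card_UN_le[OF fin(3)]]
        sum_mono card_UN_le[OF fin(2)])
  finally have "real (card {z \<in> square_divisor_tail Y. ht z < X})
      \<le> real (card B0) + (\<Sum>p\<in>P1. real (card (B1 p))) + (\<Sum>i\<in>I. \<Sum>p\<in>P2. real (card (B2 i p)))"
    unfolding of_nat_sum[symmetric] of_nat_add[symmetric] of_nat_le_iff .
  also have "\<dots> \<le> (4 * s + 1) + (\<Sum>p\<in>P1. 10 * a * s * (1 / real p ^ 2))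
      + (\<Sum>i\<in>I. \<Sum>p\<in>P2. 8 * s * (1 / real p ^ 2) + 2)"
    by (intro add_mono card0 sum_mono card1 card2)
  also have "\<dots> = (4 * s + 1) + 10 * a * s * (\<Sum>p\<in>P1. 1 / real p ^ 2)
      + real (card I) * (8 * s * (\<Sum>p\<in>P2. 1 / real p ^ 2) + 2 * real (card P2))"
    by (simp add: sum_distrib_left sum.distrib)
  \<comment> \<open>There are at most \<open>2 a + 1 \<le> 3 a\<close> values of \<open>i\<close>,
    and both sums over primes above \<open>Y\<close> are at most \<open>1 / Y\<close>. The constants
    collect to \<open>34 = 10 + 3 * 8\<close> and \<open>6 = 3 * 2\<close>.\<close>
  also have "\<dots> \<le> (4 * s + 1) + 10 * a * s * (1 / real Y)
      + (3 * a) * (8 * s * (1 / real Y) + 2 * real (card {p::nat. prime p \<and> real p \<le> 3 * s}))"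
  proof (intro add_mono mult_mono order_refl)
    show "(\<Sum>p\<in>P1. 1 / (real p)\<^sup>2) \<le> 1 / real Y" "(\<Sum>p\<in>P2. 1 / (real p)\<^sup>2) \<le> 1 / real Y"
      using fin assms by (intro sum_inverse_squares_le; auto simp: P1_def P2_def)+
    show "real (card I) \<le> 3 * a" using card_multiples_le(1)[of 1 a] a1 by (simp add: I_def)
    show "real (card P2) \<le> real (card {p::nat. prime p \<and> real p \<le> 3 * s})"
      unfolding of_nat_le_iff by (intro card_mono) (auto simp: P2_def)
  qed (use a1 s1 in \<open>auto intro!: sum_nonneg add_nonneg_nonneg mult_nonneg_nonneg\<close>)
  finally show ?thesis by (simp add: algebra_simps)
qed

lemma eventually_tail_le:
  assumes "Y \<ge> 2" "e > 0"
  shows "\<forall>\<^sub>F X in at_top. real (card {z \<in> square_divisor_tail Y. ht z < X}) / X powr (5/6) < 34 / real Y + e"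
proof -
  define \<pi> where "\<pi> x = real (card {p::nat. prime p \<and> real p \<le> x})" for x
  \<comment> \<open>Here \<open>18 = 6 * 3\<close>: the last term of \<open>tail_bound\<close>,
    divided by \<open>X^(5/6) = a s\<close>, is rewritten with the denominator \<open>3 s\<close>,
    to which the density of the primes refers.\<close>
  let ?g = "\<lambda>X::real. (4 * sqrt X + 1) / X powr (5/6) + 34 / real Y + 18 * (\<pi> (3 * sqrt X) / (3 * sqrt X))"
  have "((\<lambda>X::real. \<pi> (3 * sqrt X) / (3 * sqrt X)) \<longlongrightarrow> 0) at_top"
  proof (rule filterlim_compose[of "\<lambda>x. \<pi> x / x" _ at_top])
    show "((\<lambda>x. \<pi> x / x) \<longlongrightarrow> 0) at_top" unfolding \<pi>_def by (rule primes_density_zero)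
    show "filterlim (\<lambda>X::real. 3 * sqrt X) at_top at_top" by real_asymp
  qed
  moreover have "((\<lambda>X::real. (4 * sqrt X + 1) / X powr (5/6)) \<longlongrightarrow> 0) at_top" by real_asymp
  ultimately have "(?g \<longlongrightarrow> 0 + 34 / real Y + 18 * 0) at_top" by (intro tendsto_intros)
  then have "\<forall>\<^sub>F X in at_top. ?g X < 34 / real Y + e"
    using order_tendstoD(2)[of ?g "34 / real Y" at_top "34 / real Y + e"] assms by simp
  then show ?thesis using eventually_ge_at_top[of 1]
  proof eventually_elim
    case (elim X)
    have eq: "X powr (5/6) = X powr (1/3) * sqrt X"
      using elim by (simp add: powr_half_sqrt[symmetric] flip: powr_add)
    have pos: "X powr (1/3) > 0" "sqrt X > 0" using elim by auto
    have "real (card {z \<in> square_divisor_tail Y. ht z < X}) / X powr (5/6)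
       \<le> (4 * sqrt X + 1 + 34 * X powr (1/3) * sqrt X / real Y + 6 * X powr (1/3) * \<pi> (3 * sqrt X)) / X powr (5/6)"
      unfolding \<pi>_def by (intro divide_right_mono tail_bound assms elim) simp
    also have "\<dots> = ?g X"
    proof -
      have "34 * X powr (1/3) * sqrt X / real Y / X powr (5/6) = 34 / real Y"
        using pos unfolding eq by simp
      moreover have "6 * X powr (1/3) * \<pi> (3 * sqrt X) / X powr (5/6) = 18 * (\<pi> (3 * sqrt X) / (3 * sqrt X))"
        using pos unfolding eq by simp
      ultimately show ?thesis by (simp only: add_divide_distrib)
    qed
    finally show ?case using elim by linarith
  qed
qed

text \<open>Cubing is injective, so \<open>j\<close> determines \<open>i\<close> and there are only
  \<open>O(X^(1/2))\<close> such points.\<close>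

lemma has_density_discriminant_zero: "has_density {(i, j). 4 * i ^ 3 = j ^ 2} 0"
  unfolding has_density_def
proof (rule tendsto_sandwich)
  show "((\<lambda>X::real. 0::real) \<longlongrightarrow> 0) at_top" by simp
  show "((\<lambda>X::real. (4 * sqrt X + 1) / X powr (5/6)) \<longlongrightarrow> 0) at_top" by real_asymp
  show "\<forall>\<^sub>F X in at_top. 0 \<le> real (card {z \<in> {(i::int, j). 4 * i ^ 3 = j ^ 2}. ht z < X}) / X powr (5/6)"
    by simp
  show "\<forall>\<^sub>F X in at_top. real (card {z \<in> {(i::int, j). 4 * i ^ 3 = j ^ 2}. ht z < X}) / X powr (5/6)
      \<le> (4 * sqrt X + 1) / X powr (5/6)"
    using eventually_gt_at_top[of 0]
  proof eventually_elim
    case (elim X)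
    let ?A = "{z \<in> {(i::int, j). 4 * i ^ 3 = j ^ 2}. ht z < X}"
    have "inj_on snd ?A"
    proof (rule inj_onI)
      fix x y assume "x \<in> ?A" "y \<in> ?A" "snd x = snd y"
      then have "fst x ^ 3 = fst y ^ 3" by auto
      then have "real_of_int (fst x) ^ 3 = real_of_int (fst y) ^ 3" by (simp only: of_int_power_eq_of_int_cancel_iff flip: of_int_power)
      then have "root 3 (real_of_int (fst x) ^ 3) = root 3 (real_of_int (fst y) ^ 3)" by (simp only:)
      then have "fst x = fst y" by (simp add: odd_real_root_power_cancel)
      then show "x = y" using \<open>snd x = snd y\<close> by (simp add: prod_eq_iff)
    qed
    then have "card ?A = card (snd ` ?A)" by (simp add: card_image)
    also have "\<dots> \<le> card {j::int. int 1 dvd j \<and> \<bar>real_of_int j\<bar> < 2 * sqrt X}"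
      using ht_less_iff[OF elim] by (intro card_mono) auto
    finally have "real (card ?A) \<le> 4 * sqrt X + 1"
      using card_multiples_le(1)[of 1 "2 * sqrt X"] elim by simp
    then show ?case by (intro divide_right_mono) auto
  qed
qed

section \<open>Local densities at large primes\<close>

text \<open>If \<open>p\<close> divides \<open>a\<close> it also divides \<open>b\<close>, which
  leaves at most \<open>p^2\<close> pairs; each of the at most \<open>p^2\<close> other values of
  \<open>a\<close> admits at most two \<open>b\<close>.\<close>

lemma card_discriminant_cells:
  assumes "prime p" "p > 2"
  shows "card {(a, b) \<in> cells p 2. int p ^ 2 dvd 4 * a ^ 3 - b ^ 2} \<le> 3 * p ^ 2"
proof -
  define q where "q = int p ^ 2"
  have q: "q > 0" using assms by (simp add: q_def)
  define A where "A = (\<lambda>k. int p * k) ` {0..<int p}"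
  define R where "R a = {b \<in> {0..<q}. q dvd 4 * a ^ 3 - b ^ 2}" for a
  have mult: "a \<in> A" if a: "int p dvd a" "0 \<le> a" "a < q" for a
  proof -
    obtain k where k: "a = int p * k" using a(1) by (rule dvdE)
    have "0 \<le> k" "k < int p"
      using a assms unfolding k q_def power2_eq_square by (auto simp: zero_le_mult_iff)
    then show ?thesis using k by (auto simp: A_def)
  qed
  have card_A: "card A \<le> p" unfolding A_def using card_image_le[of "{0..<int p}" "\<lambda>k. int p * k"] by simp
  have card_R: "card (R a) \<le> 2" if a: "\<not> int p dvd a" for a
  proof -
    obtain r where r: "\<And>j. q dvd 4 * a ^ 3 - j ^ 2 \<Longrightarrow> j mod q = r mod q \<or> j mod q = (- r) mod q"
      using square_roots_mod_prime_square[OF assms a] unfolding q_def by blast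
    have "R a \<subseteq> {r mod q, (- r) mod q}"
    proof
      fix b assume "b \<in> R a"
      then have "b mod q = b" "q dvd 4 * a ^ 3 - b ^ 2" by (auto simp: R_def)
      then show "b \<in> {r mod q, (- r) mod q}" using r[of b] by auto
    qed
    then have "card (R a) \<le> card {r mod q, (- r) mod q}" by (intro card_mono) auto
    also have "\<dots> \<le> 2" by (simp add: card_insert_if)
    finally show ?thesis .
  qed
  have "{(a, b) \<in> cells p 2. int p ^ 2 dvd 4 * a ^ 3 - b ^ 2}
      \<subseteq> (A \<times> A) \<union> (\<Union>a\<in>{a \<in> {0..<q}. \<not> int p dvd a}. {a} \<times> R a)"
  proof
    fix z assume "z \<in> {(a, b) \<in> cells p 2. int p ^ 2 dvd 4 * a ^ 3 - b ^ 2}"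
    then obtain a b where z: "z = (a, b)" "0 \<le> a" "a < q" "0 \<le> b" "b < q" and d: "int p ^ 2 dvd 4 * a ^ 3 - b ^ 2"
      by (auto simp: cells_def q_def)
    show "z \<in> (A \<times> A) \<union> (\<Union>a\<in>{a \<in> {0..<q}. \<not> int p dvd a}. {a} \<times> R a)"
    proof (cases "int p dvd a")
      case True
      have "int p dvd b" by (rule prime_square_dvd_discriminant[OF assms(1) d True])
      then show ?thesis using True z mult by simp
    next
      case False
      then show ?thesis using z d by (simp add: R_def q_def)
    qed
  qed
  moreover have fin: "finite {a \<in> {0..<q}. \<not> int p dvd a}" "finite (R a)" for a
    by (auto intro: finite_subset[of _ "{0..<q}"] simp: R_def)
  ultimately have "card {(a, b) \<in> cells p 2. int p ^ 2 dvd 4 * a ^ 3 - b ^ 2}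
      \<le> card ((A \<times> A) \<union> (\<Union>a\<in>{a \<in> {0..<q}. \<not> int p dvd a}. {a} \<times> R a))"
    by (intro card_mono finite_UnI finite_UN_I finite_cartesian_product finite.insertI finite.emptyI)
      (simp_all add: A_def)
  also have "\<dots> \<le> card (A \<times> A) + card (\<Union>a\<in>{a \<in> {0..<q}. \<not> int p dvd a}. {a} \<times> R a)"
    by (rule card_Un_le)
  also have "\<dots> \<le> p * p + (\<Sum>a\<in>{a \<in> {0..<q}. \<not> int p dvd a}. card ({a} \<times> R a))"
    using card_A by (intro add_mono card_UN_le fin) (simp add: card_cartesian_product mult_mono)
  also have "(\<Sum>a\<in>{a \<in> {0..<q}. \<not> int p dvd a}. card ({a} \<times> R a))
      \<le> (\<Sum>a\<in>{a \<in> {0..<q}. \<not> int p dvd a}. 2)"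
    using card_R by (intro sum_mono) (simp add: card_cartesian_product)
  also have "\<dots> \<le> 2 * card {0..<q}"
  proof -
    have "card {a \<in> {0..<q}. \<not> int p dvd a} \<le> card {0..<q}" by (intro card_mono) auto
    then show ?thesis by simp
  qed
  also have "card {0..<q} = p ^ 2" by (simp add: q_def nat_power_eq)
  finally show ?thesis by (simp add: power2_eq_square)
qed

section \<open>Lower bounds for the content of local conditions at large primes\<close>

lemma discriminant_cong:
  fixes i j a b q :: int
  assumes "q dvd i - a" "q dvd j - b"
  shows "q dvd 4 * i ^ 3 - j ^ 2 \<longleftrightarrow> q dvd 4 * a ^ 3 - b ^ 2"
proof -
  have "(4 * i ^ 3 - j ^ 2) - (4 * a ^ 3 - b ^ 2)
      = (i - a) * (4 * (i ^ 2 + i * a + a ^ 2)) - (j - b) * (j + b)"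
    by (simp add: algebra_simps power2_eq_square power3_eq_cube)
  moreover have "q dvd (i - a) * (4 * (i ^ 2 + i * a + a ^ 2)) - (j - b) * (j + b)"
    by (rule dvd_diff[OF dvd_mult2[OF assms(1)] dvd_mult2[OF assms(2)]])
  ultimately have "q dvd (4 * i ^ 3 - j ^ 2) - (4 * a ^ 3 - b ^ 2)" by (simp only:)
  then show ?thesis
    by (metis dvd_diffD dvd_diffD1 diff_add_cancel dvd_add_right_iff)
qed

lemma emb_residues_in_cyl_at:
  assumes "p > 0" "z \<in> Zp2 p" "n \<le> m"
  shows "emb p (fst z m, snd z m) \<in> cyl_at p n z"
  using assms Zp_coherent[OF _ assms(3)] by (auto simp: emb_in_cyl_iff Zp2_def)

text \<open>The residues of a point \<open>z\<close> at deep levels are integral points converging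
  to \<open>z\<close>. Modulo \<open>p^2\<close> they agree with \<open>(a, b)\<close>, so the
  second hypothesis puts them into \<open>S\<close>.\<close>

lemma discriminant_cyl_subset_closure:
  assumes "prime p" "\<And>i j. \<not> int p ^ 2 dvd 4 * i ^ 3 - j ^ 2 \<Longrightarrow> emb p (i, j) \<in> S"
    "\<not> int p ^ 2 dvd 4 * a ^ 3 - b ^ 2"
  shows "cyl p 2 a b \<subseteq> Zp2_top p closure_of S"
proof
  fix z assume z: "z \<in> cyl p 2 a b"
  then have zZ: "z \<in> Zp2 p" and ab: "fst z 2 = a" "snd z 2 = b" by (auto simp: cyl_def)
  have p: "p > 0" using assms(1) prime_gt_0_nat by blast
  have "cyl_at p n z \<inter> S \<noteq> {}" for n
  proof -
    \<comment> \<open>Level \<open>n\<close> places the point in the given neighbourhood of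
      \<open>z\<close>, and level 2 fixes its discriminant modulo \<open>p^2\<close>.\<close>
    define i j where "i = fst z (max n 2)" and "j = snd z (max n 2)"
    have "emb p (i, j) \<in> cyl_at p 2 z" unfolding i_def j_def
      by (rule emb_residues_in_cyl_at[OF p zZ]) simp
    then have mods: "i mod int p ^ 2 = a" "j mod int p ^ 2 = b" using p ab by (auto simp: emb_in_cyl_iff)
    have "int p ^ 2 dvd i - a" "int p ^ 2 dvd j - b" unfolding mods[symmetric] by (rule dvd_minus_mod)+
    then have "\<not> int p ^ 2 dvd 4 * i ^ 3 - j ^ 2"
      using discriminant_cong assms(3) by blast
    then have "emb p (i, j) \<in> S" by (rule assms(2))
    moreover have "emb p (i, j) \<in> cyl_at p n z" unfolding i_def j_def
      by (rule emb_residues_in_cyl_at[OF p zZ]) simp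
    ultimately show ?thesis by blast
  qed
  then show "z \<in> Zp2_top p closure_of S" using zZ by (simp add: closure_of_Zp2_iff)
qed

text \<open>At least \<open>p^4 - 3 p^2\<close> of the \<open>p^4\<close> classes modulo
  \<open>p^2\<close> have a discriminant not divisible by \<open>p^2\<close>, and each of them lies
  in the closure of \<open>S\<close>.\<close>

lemma content_ge:
  assumes "prime p" "p > 2" "\<And>i j. \<not> int p ^ 2 dvd 4 * i ^ 3 - j ^ 2 \<Longrightarrow> emb p (i, j) \<in> S"
  shows "1 - 3 / real p ^ 2 \<le> content_Zp2 p S"
proof -
  have p: "p > 0" using assms by simp
  define B where "B = {(a, b) \<in> cells p 2. int p ^ 2 dvd 4 * a ^ 3 - b ^ 2}"
  have BC: "B \<subseteq> cells p 2" by (auto simp: B_def)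
  have "card (cells p 2 - B) = p ^ 4 - card B"
    using BC finite_subset[OF BC finite_cells] by (simp add: card_Diff_subset card_cells)
  moreover have "card B \<le> 3 * p ^ 2" unfolding B_def by (rule card_discriminant_cells[OF assms(1,2)])
  ultimately have "real (card (cells p 2 - B)) \<ge> real p ^ 4 - 3 * real p ^ 2"
    by (simp flip: of_nat_power)
  then have "(real p ^ 4 - 3 * real p ^ 2) / real p ^ 4 \<le> real (card (cells p 2 - B)) / real p ^ (2 * 2)"
    by (simp add: divide_right_mono)
  also have "\<dots> \<le> content_Zp2 p S"
  proof (rule cells_le_content[OF p])
    fix a b assume "(a, b) \<in> cells p 2 - B"
    then have "\<not> int p ^ 2 dvd 4 * a ^ 3 - b ^ 2" by (auto simp: B_def)
    then show "cyl p 2 a b \<subseteq> Zp2_top p closure_of S"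
      using assms by (intro discriminant_cyl_subset_closure) auto
  qed auto
  also have "(real p ^ 4 - 3 * real p ^ 2) / real p ^ 4 = 1 - 3 / real p ^ 2"
    using p by (simp add: field_simps power4_eq_xxxx power2_eq_square)
  finally show ?thesis .
qed

section \<open>Convergence of the Euler products\<close>

lemma convergent_prod_primes:
  fixes m :: "nat \<Rightarrow> real"
  assumes "\<And>p. prime p \<Longrightarrow> p \<ge> N \<Longrightarrow> 1 - 3 / real p ^ 2 \<le> m p \<and> m p \<le> 1"
  shows "convergent_prod (\<lambda>p. if prime p then m p else 1)"
proof -
  have "summable (\<lambda>n. 3 * inverse (real n ^ 2))"
    by (intro summable_mult inverse_power_summable) simp
  then have "summable (\<lambda>p. norm ((if prime p then m p else 1) - 1))"
  proof (rule summable_comparison_test'[where N = N])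
    fix n assume "n \<ge> N"
    then show "norm (norm ((if prime n then m n else 1) - 1)) \<le> 3 * inverse (real n ^ 2)"
      using assms[of n] by (auto simp: inverse_eq_divide)
  qed
  then show ?thesis
    by (intro abs_convergent_prod_imp_convergent_prod summable_imp_abs_convergent_prod)
qed

section \<open>The sieve\<close>

definition local_points :: "(nat \<Rightarrow> ((nat \<Rightarrow> int) \<times> (nat \<Rightarrow> int)) set) \<Rightarrow> (int \<times> int) set" where
  "local_points S = {z. 4 * fst z ^ 3 \<noteq> snd z ^ 2 \<and> (\<forall>p. prime p \<longrightarrow> emb p z \<in> S p)}"

text \<open>Points that meet the conditions at all primes up to a large \<open>n\<close> but fail a
  later one have discriminant zero or lie in \<open>square_divisor_tail n\<close>. Finitely many
  vanishing factors are compatible with \<open>convergent_prod\<close>, so contents equal to 0 need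
  no separate treatment.\<close>

theorem has_density_local_points:
  assumes "\<And>p. prime p \<Longrightarrow> S p \<subseteq> Zp2 p"
    and "\<And>p. prime p \<Longrightarrow> Zp2_top p frontier_of S p \<in> null_sets (haar_Zp2 p)"
    and large: "\<And>p i j. prime p \<Longrightarrow> p \<ge> N \<Longrightarrow> \<not> int p ^ 2 dvd 4 * i ^ 3 - j ^ 2 \<Longrightarrow> emb p (i, j) \<in> S p"
  defines "f \<equiv> (\<lambda>p. if prime p then content_Zp2 p (S p) else 1)"
  shows "convergent_prod f" "has_density (local_points S) (8 * prodinf f)"
proof -
  show conv: "convergent_prod f"
    unfolding f_def
  proof (rule convergent_prod_primes[where N = "max N 3"])
    fix p :: nat assume "prime p" "max N 3 \<le> p"
    then show "1 - 3 / real p ^ 2 \<le> content_Zp2 p (S p) \<and> content_Zp2 p (S p) \<le> 1"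
      using large by (intro conjI content_ge content_le_one) auto
  qed
  have lim: "(\<lambda>n. 8 * (\<Prod>p\<le>n. f p)) \<longlonglongrightarrow> 8 * prodinf f"
    by (intro tendsto_intros convergent_prod_LIMSEQ conv)
  show "has_density (local_points S) (8 * prodinf f)"
    unfolding has_density_def
  proof (rule tendstoI)
    fix e :: real assume e: "e > 0"
    \<comment> \<open>Four errors below \<open>e / 4\<close> are allotted: to the partial product,
      to the density of \<open>U\<close>, to the tail (\<open>34 / n\<close> plus
      \<open>e / 8\<close>) and to the points of discriminant zero.\<close>
    have "\<forall>\<^sub>F n in sequentially. dist (8 * (\<Prod>p\<le>n. f p)) (8 * prodinf f) < e / 4"
      using e by (intro tendstoD lim) simp
    moreover have "\<forall>\<^sub>F n in sequentially. 34 / real n < e / 8"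
      using e by real_asymp
    moreover note eventually_ge_at_top[of N] eventually_ge_at_top[of 2]
    ultimately have "\<forall>\<^sub>F n in sequentially. dist (8 * (\<Prod>p\<le>n. f p)) (8 * prodinf f) < e / 4
        \<and> 34 / real n < e / 8 \<and> N \<le> n \<and> 2 \<le> n"
      by eventually_elim simp
    then obtain n where n: "dist (8 * (\<Prod>p\<le>n. f p)) (8 * prodinf f) < e / 4"
        "34 / real n < e / 8" "N \<le> n" "2 \<le> n"
      using eventually_happens'[OF sequentially_bot] by blast
    define T where "T = {p. p \<le> n \<and> prime p}"
    define U where "U = {z. \<forall>p\<in>T. emb p z \<in> S p}"
    have T: "finite T" by (simp add: T_def)
    have "(\<Prod>p\<in>T. content_Zp2 p (S p)) = (\<Prod>p\<le>n. f p)"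
      by (rule prod.mono_neutral_cong_left) (auto simp: T_def f_def)
    \<comment> \<open>The vacuous congruence modulo 1 makes the local theorem start from the whole
      plane.\<close>
    moreover have "has_density {z. fst z mod 1 = 0 \<and> snd z mod 1 = 0 \<and> (\<forall>p\<in>T. emb p z \<in> S p)}
        (8 / real_of_int 1 ^ 2 * (\<Prod>p\<in>T. content_Zp2 p (S p)))"
      by (rule has_density_local_conditions[OF T]) (simp_all add: T_def assms(1,2))
    ultimately have "has_density U (8 * (\<Prod>p\<le>n. f p))"
      by (simp add: U_def)
    then have densU: "\<forall>\<^sub>F X in at_top. dist (real (card {z \<in> U. ht z < X}) / X powr (5/6)) (8 * (\<Prod>p\<le>n. f p)) < e / 4"
      unfolding has_density_def using e by (intro tendstoD) auto
    have tail: "\<forall>\<^sub>F X in at_top. real (card {z \<in> square_divisor_tail n. ht z < X}) / X powr (5/6) < 34 / real n + e / 8"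
      using n e by (intro eventually_tail_le) auto
    have zero: "\<forall>\<^sub>F X in at_top. real (card {z \<in> {(i, j). 4 * i ^ 3 = j ^ 2}. ht z < X}) / X powr (5/6) < e / 4"
      by (rule order_tendstoD(2)[OF has_density_discriminant_zero[unfolded has_density_def]]) (use e in simp)
    have sub: "local_points S \<subseteq> U" by (auto simp: local_points_def U_def T_def)
    have cover: "U \<subseteq> local_points S \<union> (square_divisor_tail n \<union> {(i, j). 4 * i ^ 3 = j ^ 2})"
    proof
      fix z assume z: "z \<in> U"
      show "z \<in> local_points S \<union> (square_divisor_tail n \<union> {(i, j). 4 * i ^ 3 = j ^ 2})"
      proof (cases "z \<in> square_divisor_tail n \<union> {(i, j). 4 * i ^ 3 = j ^ 2}")
        case False
        obtain i j where ij: "z = (i, j)" by (cases z)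
        have ne: "4 * i ^ 3 \<noteq> j ^ 2" using False by (simp add: ij)
        have "emb p z \<in> S p" if p: "prime p" for p
        proof (cases "p \<le> n")
          case True
          then show ?thesis using z p by (simp add: U_def T_def)
        next
          case pn: False
          have "\<not> int p ^ 2 dvd 4 * i ^ 3 - j ^ 2"
            using False ne p pn by (auto simp: ij square_divisor_tail_def)
          then show ?thesis using large[OF p, of i j] pn n(3) by (simp add: ij)
        qed
        then show ?thesis using ne by (simp add: local_points_def ij)
      qed blast
    qed
    show "\<forall>\<^sub>F X in at_top. dist (real (card {z \<in> local_points S. ht z < X}) / X powr (5/6)) (8 * prodinf f) < e"
      using densU tail zero
    proof eventually_elim
      case (elim X)
      have "card {z \<in> local_points S. ht z < X} \<le> card {z \<in> U. ht z < X}"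
        using sub by (intro card_mono) auto
      then have 1: "real (card {z \<in> local_points S. ht z < X}) / X powr (5/6) \<le> real (card {z \<in> U. ht z < X}) / X powr (5/6)"
        by (intro divide_right_mono) auto
      have "card {z \<in> U. ht z < X} \<le> card ({z \<in> local_points S. ht z < X} \<union>
          ({z \<in> square_divisor_tail n. ht z < X} \<union> {z \<in> {(i, j). 4 * i ^ 3 = j ^ 2}. ht z < X}))"
        using cover by (intro card_mono finite_UnI finite_ht') blast
      also have "\<dots> \<le> card {z \<in> local_points S. ht z < X} +
          (card {z \<in> square_divisor_tail n. ht z < X} + card {z \<in> {(i, j). 4 * i ^ 3 = j ^ 2}. ht z < X})"
        by (intro order_trans[OF card_Un_le] add_mono order_refl card_Un_le)
      finally have "real (card {z \<in> U. ht z < X}) \<le> real (card {z \<in> local_points S. ht z < X}) +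
          (real (card {z \<in> square_divisor_tail n. ht z < X}) + real (card {z \<in> {(i, j). 4 * i ^ 3 = j ^ 2}. ht z < X}))"
        unfolding of_nat_add[symmetric] of_nat_le_iff .
      then have "real (card {z \<in> U. ht z < X}) / X powr (5/6) \<le> (real (card {z \<in> local_points S. ht z < X}) +
          (real (card {z \<in> square_divisor_tail n. ht z < X}) + real (card {z \<in> {(i, j). 4 * i ^ 3 = j ^ 2}. ht z < X}))) / X powr (5/6)"
        by (intro divide_right_mono) auto
      then show ?case
        using 1 elim n(1,2) unfolding dist_real_def add_divide_distrib by linarith
    qed
  qed
qed

section \<open>Invariants of minimal models\<close>

text \<open>Minimality of the model read off from \<open>I = -3 A\<close> and
  \<open>J = -27 B\<close>. At 3 these factors shift the exponents 4 and 6 to 5 and 9, and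
  divisibility by 3 and 27 records that \<open>A\<close> and \<open>B\<close> are integers; at the
  other primes 3 is a unit.\<close>

definition minimal_at :: "nat \<Rightarrow> int \<times> int \<Rightarrow> bool" where
  "minimal_at p z \<longleftrightarrow>
    (if p = 3 then 3 dvd fst z \<and> 27 dvd snd z \<and> \<not> (3 ^ 5 dvd fst z \<and> 3 ^ 9 dvd snd z)
     else \<not> (int p ^ 4 dvd fst z \<and> int p ^ 6 dvd snd z))"

text \<open>Level 9 suffices because every prime power in \<open>minimal_at\<close> divides
  \<open>p^9\<close>.\<close>

definition minimal_plane :: "nat \<Rightarrow> ((nat \<Rightarrow> int) \<times> (nat \<Rightarrow> int)) set" where
  "minimal_plane p = {z \<in> Zp2 p. minimal_at p (fst z 9, snd z 9)}"

lemma minimal_at_mod: "minimal_at p (i mod int p ^ 9, j mod int p ^ 9) \<longleftrightarrow> minimal_at p (i, j)"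
proof (cases "p = 3")
  case True
  have "d dvd k mod int p ^ 9 \<longleftrightarrow> d dvd k" if "d dvd int p ^ 9" for d k :: int
    using that by (rule dvd_mod_iff)
  from this[of 3] this[of 27] this[of "3 ^ 5"] this[of "3 ^ 9"] show ?thesis
    using True by (simp add: minimal_at_def)
next
  case False
  have "int p ^ 4 dvd k mod int p ^ 9 \<longleftrightarrow> int p ^ 4 dvd k" "int p ^ 6 dvd k mod int p ^ 9 \<longleftrightarrow> int p ^ 6 dvd k" for k
    by (rule dvd_mod_iff, rule le_imp_power_dvd, simp)+
  then show ?thesis using False by (simp add: minimal_at_def)
qed

lemma emb_minimal_plane_iff: "p > 0 \<Longrightarrow> emb p z \<in> minimal_plane p \<longleftrightarrow> minimal_at p z"
  using emb_Zp2[of p z] minimal_at_mod[of p "fst z" "snd z"]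
  by (simp add: minimal_plane_def emb_def of_int_Zp_def)

text \<open>Residues at level 9 decide membership, so the set is both open and closed.\<close>

lemma frontier_minimal_plane: "Zp2_top p frontier_of minimal_plane p = {}"
proof -
  have cyl: "cyl_at p 9 z \<subseteq> minimal_plane p" if "z \<in> minimal_plane p" for z
    using that by (auto simp: minimal_plane_def cyl_def)
  have "openin (Zp2_top p) (minimal_plane p)"
  proof (subst openin_subopen, rule ballI)
    fix z assume z: "z \<in> minimal_plane p"
    then have "z \<in> cyl_at p 9 z" by (intro in_cyl_at) (simp add: minimal_plane_def)
    then show "\<exists>T. openin (Zp2_top p) T \<and> z \<in> T \<and> T \<subseteq> minimal_plane p"
      by (intro exI[of _ "cyl_at p 9 z"] conjI openin_cyl cyl[OF z])
  qed
  moreover have "closedin (Zp2_top p) (minimal_plane p)"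
    unfolding closure_of_subset_eq[symmetric]
  proof (intro conjI subsetI)
    fix z assume "z \<in> Zp2_top p closure_of minimal_plane p"
    then have "z \<in> Zp2 p" "cyl_at p 9 z \<inter> minimal_plane p \<noteq> {}"
      by (auto simp: closure_of_Zp2_iff)
    then show "z \<in> minimal_plane p" by (auto simp: minimal_plane_def cyl_def)
  qed (auto simp: minimal_plane_def)
  ultimately show ?thesis
    using clopenin_eq_frontier_of[of "Zp2_top p" "minimal_plane p"] by blast
qed

lemma minimal_at_model:
  assumes "prime p"
  shows "minimal_at p (- 3 * A, - 27 * B) \<longleftrightarrow> \<not> (int p ^ 4 dvd A \<and> int p ^ 6 dvd B)"
proof (cases "p = 3")
  case True
  have "(3::int) ^ 5 dvd - 3 * A \<longleftrightarrow> 3 ^ 4 dvd A"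
    using dvd_mult_cancel_left[of "- 3" "3 ^ 4" A] by simp
  moreover have "(3::int) ^ 9 dvd - 27 * B \<longleftrightarrow> 3 ^ 6 dvd B"
    using dvd_mult_cancel_left[of "- 27" "3 ^ 6" B] by simp
  ultimately show ?thesis using True by (simp add: minimal_at_def)
next
  case False
  have "coprime (int p) (int 3)"
    using assms False by (simp only: coprime_int_iff) (intro primes_coprime, auto)
  then have "coprime (int p ^ k) (3 ^ l)" for k l
    by (simp only: of_nat_numeral coprime_power_left_iff coprime_power_right_iff) simp
  from this[of 4 1] this[of 6 3] have "coprime (int p ^ 4) 3" "coprime (int p ^ 6) 27"
    by (simp_all only: power_one_right) simp_all
  then have "int p ^ 4 dvd 3 * A \<longleftrightarrow> int p ^ 4 dvd A" "int p ^ 6 dvd 27 * B \<longleftrightarrow> int p ^ 6 dvd B"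
    by (simp_all only: coprime_dvd_mult_right_iff)
  then show ?thesis
    using False by (simp add: minimal_at_def)
qed

text \<open>The discriminants agree up to a constant:
  \<open>4 I^3 - J^2 = -27 (4 A^3 + 27 B^2)\<close>.\<close>

lemma elliptic_curves_iff:
  "E \<in> elliptic_curves \<longleftrightarrow> 4 * invI E ^ 3 \<noteq> invJ E ^ 2 \<and> (\<forall>p. prime p \<longrightarrow> minimal_at p (invI E, invJ E))"
proof -
  obtain A B where E: "E = (A, B)" by (cases E)
  have "4 * invI E ^ 3 - invJ E ^ 2 = - 27 * (4 * A ^ 3 + 27 * B ^ 2)"
    by (simp add: invI_def invJ_def E power_mult_distrib)
  then have "4 * invI E ^ 3 - invJ E ^ 2 = 0 \<longleftrightarrow> 4 * A ^ 3 + 27 * B ^ 2 = 0"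
    by (simp only: mult_eq_0_iff) simp
  then have "4 * invI E ^ 3 = invJ E ^ 2 \<longleftrightarrow> 4 * A ^ 3 + 27 * B ^ 2 = 0"
    by (simp only: right_minus_eq)
  moreover have "(\<forall>p. prime p \<longrightarrow> minimal_at p (invI E, invJ E)) \<longleftrightarrow>
      \<not> (\<exists>p::int. prime p \<and> p ^ 4 dvd A \<and> p ^ 6 dvd B)"
  proof -
    \<comment> \<open>The prime in \<open>elliptic_curves\<close> is an integer, while the local
      conditions are indexed by natural numbers; prime integers are positive by convention.\<close>
    have "(\<exists>p::int. prime p \<and> p ^ 4 dvd A \<and> p ^ 6 dvd B) \<longleftrightarrow>
        (\<exists>p::nat. prime p \<and> int p ^ 4 dvd A \<and> int p ^ 6 dvd B)"
    proof
      assume "\<exists>p::int. prime p \<and> p ^ 4 dvd A \<and> p ^ 6 dvd B"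
      then obtain p :: int where p: "prime p" "p ^ 4 dvd A" "p ^ 6 dvd B" by blast
      then have "int (nat p) = p" using prime_gt_0_int[of p] by simp
      then have "prime (nat p) \<and> int (nat p) ^ 4 dvd A \<and> int (nat p) ^ 6 dvd B"
        using p by (simp only: prime_int_nat_transfer[of p])
      then show "\<exists>p::nat. prime p \<and> int p ^ 4 dvd A \<and> int p ^ 6 dvd B" by blast
    next
      assume "\<exists>p::nat. prime p \<and> int p ^ 4 dvd A \<and> int p ^ 6 dvd B"
      then obtain p :: nat where "prime p" "int p ^ 4 dvd A" "int p ^ 6 dvd B" by blast
      then show "\<exists>p::int. prime p \<and> p ^ 4 dvd A \<and> p ^ 6 dvd B" by (intro exI[of _ "int p"]) simp
    qed
    then show ?thesis using minimal_at_model[of _ A B] by (auto simp: invI_def invJ_def E)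
  qed
  ultimately show ?thesis by (simp add: elliptic_curves_def E)
qed

section \<open>Bijection between a family and the integral points of its local conditions\<close>

lemma padic_invariants_eq: "padic_invariants p E = emb p (invI E, invJ E)"
  by (simp add: padic_invariants_def emb_def)

text \<open>Every point on the right comes from a curve because minimality at 3 makes
  \<open>I\<close> divisible by 3 and \<open>J\<close> by 27, which recovers integral
  \<open>A\<close> and \<open>B\<close>.\<close>

lemma invariants_family:
  "(\<lambda>E. (invI E, invJ E)) ` family C = local_points (\<lambda>p. C p \<inter> minimal_plane p)"
proof
  show "(\<lambda>E. (invI E, invJ E)) ` family C \<subseteq> local_points (\<lambda>p. C p \<inter> minimal_plane p)"
    by (auto simp: family_def elliptic_curves_iff local_points_def padic_invariants_eq
        emb_minimal_plane_iff prime_gt_0_nat)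
  show "local_points (\<lambda>p. C p \<inter> minimal_plane p) \<subseteq> (\<lambda>E. (invI E, invJ E)) ` family C"
  proof
    fix z assume z: "z \<in> local_points (\<lambda>p. C p \<inter> minimal_plane p)"
    then have min: "minimal_at p z" "emb p z \<in> C p" if "prime p" for p
      using that by (auto simp: local_points_def emb_minimal_plane_iff prime_gt_0_nat)
    have "minimal_at 3 z" by (rule min) simp
    then have "3 dvd fst z" "27 dvd snd z" by (auto simp: minimal_at_def)
    then obtain A B where "fst z = 3 * A" "snd z = 27 * B" by (auto elim!: dvdE)
    then have inv: "invI (- A, - B) = fst z" "invJ (- A, - B) = snd z" by (simp_all add: invI_def invJ_def)
    have "(- A, - B) \<in> family C"
      using z min by (simp add: family_def elliptic_curves_iff padic_invariants_eq local_points_def inv)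
    then show "z \<in> (\<lambda>E. (invI E, invJ E)) ` family C"
      by (rule rev_image_eqI) (simp add: inv)
  qed
qed

lemma count_family:
  "count_height_less (family C) X = card {z \<in> local_points (\<lambda>p. C p \<inter> minimal_plane p). ht z < X}"
proof -
  have "inj_on (\<lambda>E. (invI E, invJ E)) {E \<in> family C. height E < X}"
    by (auto simp: inj_on_def invI_def invJ_def)
  then have "card {E \<in> family C. height E < X} = card ((\<lambda>E. (invI E, invJ E)) ` {E \<in> family C. height E < X})"
    by (rule card_image[symmetric])
  also have "(\<lambda>E. (invI E, invJ E)) ` {E \<in> family C. height E < X}
      = {z \<in> (\<lambda>E. (invI E, invJ E)) ` family C. ht z < X}"
    by (auto simp: height_def ht_def)
  finally show ?thesis by (simp add: count_height_less_def invariants_family)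
qed

section \<open>Acceptable families\<close>

lemma of_int_Zp_mult: "of_int_Zp p a \<otimes>\<^bsub>Zp p\<^esub> of_int_Zp p b = of_int_Zp p (a * b)"
  by (simp add: Zp_def of_int_Zp_def mod_mult_eq)

lemma of_int_Zp_add: "of_int_Zp p a \<oplus>\<^bsub>Zp p\<^esub> of_int_Zp p b = of_int_Zp p (a + b)"
  by (simp add: Zp_def of_int_Zp_def mod_add_eq)

lemma of_int_Zp_pow: "of_int_Zp p a [^]\<^bsub>Zp p\<^esub> (n::nat) = of_int_Zp p (a ^ n)"
proof (induction n)
  case 0
  show ?case by (simp add: nat_pow_def) (simp add: Zp_def of_int_Zp_def)
next
  case (Suc n)
  have "of_int_Zp p a [^]\<^bsub>Zp p\<^esub> Suc n = of_int_Zp p a [^]\<^bsub>Zp p\<^esub> n \<otimes>\<^bsub>Zp p\<^esub> of_int_Zp p a"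
    by (simp add: nat_pow_def)
  then show ?case by (simp add: Suc of_int_Zp_mult mult.commute)
qed

lemma disc_Zp_of_int: "disc_Zp p (of_int_Zp p A) (of_int_Zp p B) = of_int_Zp p (16 * (4 * A ^ 3 + 27 * B ^ 2))"
  by (simp add: disc_Zp_def of_int_Zp_mult of_int_Zp_add of_int_Zp_pow)

text \<open>At level 2 the image of \<open>p^2\<close> is 0, and hence so is that of each of its
  multiples.\<close>

lemma divides_of_int_ZpD:
  assumes "of_int_Zp p (int p ^ 2) divides\<^bsub>Zp p\<^esub> of_int_Zp p k"
  shows "int p ^ 2 dvd k"
proof -
  obtain c where "of_int_Zp p k = of_int_Zp p (int p ^ 2) \<otimes>\<^bsub>Zp p\<^esub> c"
    using assms by (auto simp: factor_def)
  then have "of_int_Zp p k 2 = (of_int_Zp p (int p ^ 2) \<otimes>\<^bsub>Zp p\<^esub> c) 2" by (rule arg_cong)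
  also have "\<dots> = 0" by (simp add: Zp_def of_int_Zp_def)
  finally show ?thesis by (simp add: of_int_Zp_def dvd_eq_mod_eq_0)
qed

text \<open>The factor 16 of \<open>disc_Zp\<close> is prime to \<open>p\<close>, so nondivisibility
  by \<open>p^2\<close> passes from \<open>4 A^3 + 27 B^2\<close> to the full discriminant.\<close>

lemma acceptable_at_model:
  assumes "acceptable_at p F" "prime p" "p > 2" "\<not> int p ^ 2 dvd 4 * A ^ 3 + 27 * B ^ 2"
  shows "emb p (- 3 * A, - 27 * B) \<in> F_inv p F"
proof -
  have "coprime (int p) (int 2)"
    using assms by (simp only: coprime_int_iff) (intro primes_coprime, auto)
  then have "coprime (int p ^ 2) (2 ^ 4)"
    by (simp only: of_nat_numeral coprime_power_left_iff coprime_power_right_iff) simp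
  then have "\<not> int p ^ 2 dvd 2 ^ 4 * (4 * A ^ 3 + 27 * B ^ 2)"
    using assms(4) by (simp only: coprime_dvd_mult_right_iff) simp
  then have "\<not> of_int_Zp p (int p ^ 2) divides\<^bsub>Zp p\<^esub> disc_Zp p (of_int_Zp p A) (of_int_Zp p B)"
    using divides_of_int_ZpD by (auto simp: disc_Zp_of_int)
  moreover have "(of_int_Zp p A, of_int_Zp p B) \<in> Zp2 p"
    using assms by (simp add: Zp2_def of_int_Zp_closed)
  ultimately have "(of_int_Zp p A, of_int_Zp p B) \<in> local_curves p F"
    using assms(1) by (auto simp: acceptable_at_def)
  then show ?thesis by (simp add: local_curves_def of_int_Zp_mult emb_def)
qed

text \<open>The pair \<open>(i, j)\<close> need not be of the form \<open>(-3 A, -27 B)\<close> with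
  integers \<open>A\<close> and \<open>B\<close>. But 3 is invertible modulo powers of
  \<open>p\<close>, so such pairs approximate it p-adically, and \<open>F_inv p F\<close> is
  closed.\<close>

lemma acceptable_at_emb:
  assumes "acceptable_at p F" "prime p" "p > 3" "\<not> int p ^ 2 dvd 4 * i ^ 3 - j ^ 2"
  shows "emb p (i, j) \<in> F_inv p F"
proof -
  have p: "p > 0" using assms by simp
  have "cyl_at p n (emb p (i, j)) \<inter> padic_invariants p ` F \<noteq> {}" for n
  proof -
    \<comment> \<open>Precision \<open>n\<close> keeps the approximation in the cylinder, and
      precision 2 preserves nondivisibility of the discriminant by \<open>p^2\<close>.\<close>
    define k where "k = max n 2"
    have "coprime (int p) (int 3)"
      using assms by (simp only: coprime_int_iff) (intro primes_coprime, auto)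
    then have cop: "coprime (- 3) (int p ^ k)" "coprime (- 27) (int p ^ k)"
      using coprime_power_right_iff[of "int p" 3 3] by (simp_all add: coprime_commute)
    obtain A' where "[- 3 * A' = 1] (mod int p ^ k)" using cong_solve_coprime_int[OF cop(1)] by blast
    then have "[- 3 * A' * i = 1 * i] (mod int p ^ k)" by (rule cong_mult) simp
    then obtain A where A: "[- 3 * A = i] (mod int p ^ k)" by (auto simp: mult.assoc)
    obtain B' where "[- 27 * B' = 1] (mod int p ^ k)" using cong_solve_coprime_int[OF cop(2)] by blast
    then have "[- 27 * B' * j = 1 * j] (mod int p ^ k)" by (rule cong_mult) simp
    then obtain B where B: "[- 27 * B = j] (mod int p ^ k)" by (auto simp: mult.assoc)
    have "int p ^ 2 dvd int p ^ k" by (rule le_imp_power_dvd) (simp add: k_def)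
    then have "int p ^ 2 dvd - 3 * A - i" "int p ^ 2 dvd - 27 * B - j"
      using A B unfolding cong_iff_dvd_diff by (blast intro: dvd_trans)+
    then have "\<not> int p ^ 2 dvd 4 * (- 3 * A) ^ 3 - (- 27 * B) ^ 2"
      using discriminant_cong assms(4) by blast
    also have "4 * (- 3 * A) ^ 3 - (- 27 * B) ^ 2 = (4 * A ^ 3 + 27 * B ^ 2) * (- 27)"
      by (simp add: power_mult_distrib)
    finally have "\<not> int p ^ 2 dvd 4 * A ^ 3 + 27 * B ^ 2" using dvd_mult2 by blast
    then have "emb p (- 3 * A, - 27 * B) \<in> F_inv p F"
      using assms by (intro acceptable_at_model) auto
    then have ne: "cyl_at p n (emb p (- 3 * A, - 27 * B)) \<inter> padic_invariants p ` F \<noteq> {}"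
      unfolding F_inv_def closure_of_Zp2_iff by blast
    have "int p ^ n dvd int p ^ k" by (rule le_imp_power_dvd) (simp add: k_def)
    then have "(- 3 * A) mod int p ^ n = i mod int p ^ n" "(- 27 * B) mod int p ^ n = j mod int p ^ n"
      using cong_dvd_modulus[OF A] cong_dvd_modulus[OF B] by (simp_all add: cong_def)
    then have "cyl_at p n (emb p (- 3 * A, - 27 * B)) = cyl_at p n (emb p (i, j))"
      by (simp add: emb_def of_int_Zp_def)
    then show ?thesis using ne by simp
  qed
  then show ?thesis using emb_Zp2[OF p] by (simp add: F_inv_def closure_of_Zp2_iff)
qed

text \<open>Hence intersecting with \<open>minimal_plane p\<close> at a large prime removes no
  integral point whose discriminant is not divisible by \<open>p^2\<close>.\<close>

lemma not_minimal_imp_dvd_discriminant: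
  assumes "\<not> minimal_at p (i, j)" "p \<noteq> 3"
  shows "int p ^ 2 dvd 4 * i ^ 3 - j ^ 2"
proof -
  have "int p ^ 2 dvd int p ^ 4" "int p dvd int p ^ 6" by (auto intro: le_imp_power_dvd dvd_power)
  then have "int p ^ 2 dvd i" "int p dvd j"
    using assms by (auto simp: minimal_at_def intro: dvd_trans)
  then show ?thesis
    by (intro dvd_diff dvd_mult dvd_power_same) (simp_all add: power3_eq_cube dvd_mult)
qed

section \<open>Comparison of \<open>M_U1\<close> with the content of the local conditions\<close>

lemma M_U1_eq_content: "M_U1 p F = content_Zp2 p (padic_invariants p ` F)"
  by (simp add: M_U1_def F_inv_def content_Zp2_def)

lemma content_F_inv: "content_Zp2 p (F_inv p F) = M_U1 p F"
  by (simp add: M_U1_def F_inv_def content_Zp2_def)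

lemma frontier_cyl: "Zp2_top p frontier_of cyl p n a b = {}"
  using clopenin_eq_frontier_of[of "Zp2_top p" "cyl p n a b"] openin_cyl[of p n a b] closedin_cyl[of p n a b]
  by blast

text \<open>Applying the sieve to a smaller cylinder in place of one of the conditions shows that the
  points satisfying all conditions are dense in the interior of each condition.\<close>

lemma content_emb_local_points:
  assumes S: "\<And>q. prime q \<Longrightarrow> S q \<subseteq> Zp2 q"
    and fr: "\<And>q. prime q \<Longrightarrow> Zp2_top q frontier_of S q \<in> null_sets (haar_Zp2 q)"
    and large: "\<And>q i j. prime q \<Longrightarrow> q \<ge> N \<Longrightarrow> \<not> int q ^ 2 dvd 4 * i ^ 3 - j ^ 2 \<Longrightarrow> emb q (i, j) \<in> S q"
    and pos: "\<And>q. prime q \<Longrightarrow> content_Zp2 q (S q) > 0"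
    and p: "prime p"
  shows "content_Zp2 p (emb p ` local_points S) = content_Zp2 p (S p)"
proof (rule antisym)
  have p0: "p > 0" using p prime_gt_0_nat by blast
  have "emb p ` local_points S \<subseteq> S p" using p by (auto simp: local_points_def)
  then show "content_Zp2 p (emb p ` local_points S) \<le> content_Zp2 p (S p)"
    by (intro content_mono p0 closure_of_mono)
  have meets: "cyl_at p n z \<inter> emb p ` local_points S \<noteq> {}" if sub: "cyl_at p n z \<subseteq> S p" and z: "z \<in> Zp2 p" for n z
  proof -
    define S' where "S' = S(p := cyl_at p n z)"
    define f where "f q = (if prime q then content_Zp2 q (S' q) else 1)" for q
    \<comment> \<open>The threshold is raised beyond \<open>p\<close>, since the shrunken condition
      at \<open>p\<close> need not contain the points required at large primes.\<close>
    have "emb q (i, j) \<in> S' q" if "prime q" "q \<ge> max N (Suc p)" "\<not> int q ^ 2 dvd 4 * i ^ 3 - j ^ 2" for q i j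
      using that large[of q i j] by (simp add: S'_def)
    moreover have "S' q \<subseteq> Zp2 q" if "prime q" for q
      using S[OF that] cyl_subset_Zp2 by (simp add: S'_def)
    moreover have "Zp2_top q frontier_of S' q \<in> null_sets (haar_Zp2 q)" if "prime q" for q
      using fr[OF that] by (simp add: S'_def frontier_cyl)
    ultimately have conv: "convergent_prod f" and dens: "has_density (local_points S') (8 * prodinf f)"
      unfolding f_def using has_density_local_points[of S' "max N (Suc p)"] by blast+
    have "content_Zp2 p (cyl_at p n z) = 1 / real p ^ (2 * n)"
      using closedin_cyl residues_in_cells[OF z] measure_cyl[OF p0]
      by (simp add: content_Zp2_def closure_of_closedin)
    \<comment> \<open>A convergent product in this sense vanishes only if one of its factors does.
      So the modified conditions have positive density and hold at some integral point.\<close>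
    then have "f q \<noteq> 0" for q
      using pos[of q] p0 by (auto simp: f_def S'_def)
    then have "prodinf f \<noteq> 0"
      using has_prod_eq_0_iff[OF convergent_prod_has_prod[OF conv]] by auto
    then have "local_points S' \<noteq> {}"
      using dens has_density_unique[OF has_density_empty, of "8 * prodinf f"] by auto
    then obtain w where w: "w \<in> local_points S'" by blast
    have "emb q w \<in> S q" if "prime q" for q
      using w that sub by (cases "q = p") (auto simp: local_points_def S'_def split: if_splits)
    then have "w \<in> local_points S" using w by (simp add: local_points_def)
    moreover have "emb p w \<in> cyl_at p n z" using w p by (auto simp: local_points_def S'_def)
    ultimately show ?thesis by blast
  qed
  have inner: "cyl p n a b \<subseteq> Zp2_top p closure_of (emb p ` local_points S)" if ab: "cyl p n a b \<subseteq> S p" for n a b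
  proof
    fix z assume z: "z \<in> cyl p n a b"
    then have zZ: "z \<in> Zp2 p" using cyl_subset_Zp2 by blast
    have "cyl_at p k z \<inter> emb p ` local_points S \<noteq> {}" for k
    proof -
      \<comment> \<open>Level \<open>n\<close> keeps the smaller cylinder inside \<open>S p\<close>,
        and level \<open>k\<close> inside the neighbourhood to be met.\<close>
      have "cyl_at p (max n k) z \<subseteq> cyl_at p n z" "cyl_at p (max n k) z \<subseteq> cyl_at p k z"
        by (intro cyl_at_antimono zZ; simp)+
      moreover have "cyl_at p (max n k) z \<subseteq> S p"
        using calculation(1) ab cyl_at_eq[OF z] by simp
      then have "cyl_at p (max n k) z \<inter> emb p ` local_points S \<noteq> {}" by (rule meets[OF _ zZ])
      ultimately show ?thesis by blast
    qed
    then show "z \<in> Zp2_top p closure_of (emb p ` local_points S)" using zZ by (simp add: closure_of_Zp2_iff)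
  qed
  show "content_Zp2 p (S p) \<le> content_Zp2 p (emb p ` local_points S)"
  \<comment> \<open>The inner cells of \<open>S p\<close> lie in the closure of the embedded points,
    and their density comes within \<open>e\<close> of the content of \<open>S p\<close>.\<close>
  proof (rule field_le_epsilon)
    fix e :: real assume "e > 0"
    then obtain n where n: "content_Zp2 p (S p) - e < real (card (inner_cells p n (S p))) / real p ^ (2 * n)"
      using content_approx[OF p0 S[OF p] fr[OF p]] by blast
    have "real (card (inner_cells p n (S p))) / real p ^ (2 * n) \<le> content_Zp2 p (emb p ` local_points S)"
      by (rule cells_le_content[OF p0 inner_cells_subset]) (rule inner, simp add: inner_cells_def)
    then show "content_Zp2 p (S p) \<le> content_Zp2 p (emb p ` local_points S) + e" using n by linarith
  qed
qed

section \<open>The volume of the height box\<close>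

text \<open>The two regions fill the box \<open>K\<close> of area \<open>2 * 4\<close> up to the
  curve \<open>4 x^3 = y^2\<close>, which is null because each vertical line meets it in at most two
  points.\<close>

lemma volume_R: "measure lborel R_plus + measure lborel R_minus = 8"
proof -
  define K :: "(real \<times> real) set" where "K = {-1<..<1} \<times> {-2<..<2}"
  define Z :: "(real \<times> real) set" where "Z = {(x, y). 4 * x ^ 3 = y ^ 2}"
  have K: "(x, y) \<in> K \<longleftrightarrow> max (\<bar>x\<bar> ^ 3) (y ^ 2 / 4) < 1" for x y
  proof -
    have "\<bar>x\<bar> ^ 3 < 1 \<longleftrightarrow> \<bar>x\<bar> < 1"
      using power_mono_iff[of 1 "\<bar>x\<bar>" 3] by (simp add: not_le[symmetric])
    moreover have "y ^ 2 / 4 < 1 \<longleftrightarrow> \<bar>y\<bar> < 2"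
      using power_mono_iff[of 2 "\<bar>y\<bar>" 2] by (simp add: not_le[symmetric])
    ultimately show ?thesis by (auto simp: K_def abs_less_iff)
  qed
  have Kopen: "open K" unfolding K_def by (intro open_Times) auto
  have "closed {z::real \<times> real. 4 * fst z ^ 3 = snd z ^ 2}"
    by (intro closed_Collect_eq continuous_intros)
  then have Zclosed: "closed Z" by (simp add: Z_def case_prod_unfold)
  have "open {z::real \<times> real. 4 * fst z ^ 3 - snd z ^ 2 > 0}" "open {z::real \<times> real. - (4 * fst z ^ 3 - snd z ^ 2) > 0}"
    by (intro open_Collect_less continuous_intros)+
  moreover have eqR: "R_plus = K \<inter> {z. 4 * fst z ^ 3 - snd z ^ 2 > 0}" "R_minus = K \<inter> {z. - (4 * fst z ^ 3 - snd z ^ 2) > 0}"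
    using K by (auto simp: R_plus_def R_minus_def)
  ultimately have open_R: "open R_plus" "open R_minus" and sub_R: "R_plus \<subseteq> K" "R_minus \<subseteq> K"
    unfolding eqR using Kopen by (auto intro: open_Int)
  have disj: "R_plus \<inter> R_minus = {}" by (auto simp: R_plus_def R_minus_def)
  have union: "R_plus \<union> R_minus = K - Z" using K by (auto simp: R_plus_def R_minus_def Z_def)
  have emK: "emeasure lborel K = 8"
  proof -
    have "emeasure (lborel \<Otimes>\<^sub>M lborel) K = emeasure lborel {-1<..<1::real} * emeasure lborel {-2<..<2::real}"
      unfolding K_def by (rule lborel.emeasure_pair_measure_Times) auto
    also have "\<dots> = 8" by (simp flip: ennreal_mult'')
    finally show ?thesis by (simp add: lborel_prod)
  qed
  have nullZ: "Z \<in> null_sets lborel"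
  proof -
    have "emeasure (lborel \<Otimes>\<^sub>M lborel) Z = (\<integral>\<^sup>+ x. emeasure lborel (Pair x -` Z) \<partial>lborel)"
      by (rule lborel.emeasure_pair_measure_alt) (unfold lborel_prod, use Zclosed in simp)
    also have "\<dots> = (\<integral>\<^sup>+ x. 0 \<partial>(lborel::real measure))"
    proof (rule nn_integral_cong)
      fix x :: real
      have "Pair x -` Z \<subseteq> {sqrt (4 * x ^ 3), - sqrt (4 * x ^ 3)}"
        by (auto simp: Z_def)
      then have "finite (Pair x -` Z)" by (rule finite_subset) simp
      then show "emeasure lborel (Pair x -` Z) = 0"
        using finite_imp_null_set_lborel by blast
    qed
    finally show ?thesis using Zclosed by (simp add: lborel_prod null_sets_def)
  qed
  have fin: "emeasure lborel R_plus \<noteq> \<infinity>" "emeasure lborel R_minus \<noteq> \<infinity>"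
    using emeasure_mono[OF sub_R(1), of lborel] emeasure_mono[OF sub_R(2), of lborel] emK Kopen
    by (auto simp: top_unique)
  have "measure lborel R_plus + measure lborel R_minus = measure lborel (R_plus \<union> R_minus)"
    using open_R by (intro measure_Union[symmetric] fin disj) auto
  also have "\<dots> = measure lborel K"
    unfolding union using nullZ Kopen by (intro measure_Diff_null_set) auto
  also have "\<dots> = 8" using emK by (simp add: measure_def)
  finally show ?thesis .
qed

section \<open>Asymptotic count of an acceptable family\<close>

theorem theorem3p9:
  fixes F :: "(int \<times> int) set"
  assumes "defined_by_local_conditions F"
    and "acceptable F"
  shows "convergent_prod (\<lambda>p. if prime p then M_U1 p F else 1) \<and>
    (\<lambda>X. real (count_height_less F X)
        - (measure lborel R_plus + measure lborel R_minus) * X powr (5/6)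
            * (\<Prod>p. if prime p then M_U1 p F else 1))
      \<in> o[at_top](\<lambda>X. X powr (5/6))"
proof -
  obtain C where C: "local_conditions C" "F = family C"
    using assms(1) by (auto simp: defined_by_local_conditions_def)
  define S where "S p = C p \<inter> minimal_plane p" for p
  define f where "f p = (if prime p then content_Zp2 p (S p) else 1)" for p
  define g where "g p = (if prime p then M_U1 p F else 1)" for p
  have "\<forall>\<^sub>F p in sequentially. prime p \<longrightarrow> acceptable_at p F \<and> closedin (Zp2_top p) (C p)"
    using assms(2)[unfolded acceptable_def] C(1)[unfolded local_conditions_def, THEN conjunct2]
    by eventually_elim blast
  then obtain N0 where N0: "\<And>p. p \<ge> N0 \<Longrightarrow> prime p \<Longrightarrow> acceptable_at p F \<and> closedin (Zp2_top p) (C p)"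
    by (auto simp: eventually_sequentially)
  \<comment> \<open>The bound 4 excludes the primes 2 and 3, at which 16 or 27 fails to be a
    unit.\<close>
  define N where "N = max N0 4"
  have S_eq: "(\<lambda>p. C p \<inter> minimal_plane p) = S" by (simp add: fun_eq_iff S_def)
  have S: "S p \<subseteq> Zp2 p" for p by (auto simp: S_def minimal_plane_def)
  have fr: "Zp2_top p frontier_of S p \<in> null_sets (haar_Zp2 p)" if p: "prime p" for p
  proof -
    have "Zp2_top p frontier_of S p \<subseteq> Zp2_top p frontier_of C p"
      unfolding S_def using frontier_of_Int_subset[of "Zp2_top p" "C p" "minimal_plane p"]
      by (simp add: frontier_minimal_plane)
    moreover have "Zp2_top p frontier_of S p \<in> sets (haar_Zp2 p)"
      using p by (intro closed_Zp2_sets closedin_frontier_of prime_gt_0_nat)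
    ultimately show ?thesis
      using C(1) p by (auto simp: local_conditions_def intro: null_sets_subset)
  qed
  have F_inv: "emb p (i, j) \<in> F_inv p F" if "prime p" "p \<ge> N" "\<not> int p ^ 2 dvd 4 * i ^ 3 - j ^ 2" for p i j
    using that N0[of p] by (intro acceptable_at_emb) (auto simp: N_def)
  have large: "emb p (i, j) \<in> S p" if p: "prime p" "p \<ge> N" "\<not> int p ^ 2 dvd 4 * i ^ 3 - j ^ 2" for p i j
  proof -
    have "padic_invariants p ` F \<subseteq> C p" using p by (auto simp: C(2) family_def)
    \<comment> \<open>Acceptability only places points in the closure \<open>F_inv p F\<close>;
      closedness of \<open>C p\<close> at large primes brings them back into
      \<open>C p\<close>.\<close>
    then have "F_inv p F \<subseteq> C p"
      using N0[of p] p unfolding F_inv_def by (intro closure_of_minimal) (auto simp: N_def)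
    moreover have "minimal_at p (i, j)"
      using not_minimal_imp_dvd_discriminant[of p i j] p by (auto simp: N_def)
    ultimately show ?thesis
      using F_inv[OF p] p(1) by (auto simp: S_def emb_minimal_plane_iff prime_gt_0_nat)
  qed
  have conv_f: "convergent_prod f" and dens: "has_density (local_points S) (8 * prodinf f)"
    unfolding f_def using has_density_local_points[of S N] S fr large by blast+
  have conv_g: "convergent_prod g"
    unfolding g_def
  \<comment> \<open>The closure \<open>F_inv p F\<close> contains the same integral points as
    required of \<open>S p\<close>, so its product converges before the two products are
    compared.\<close>
  proof (rule convergent_prod_primes[where N = N])
    fix p :: nat assume p: "prime p" "p \<ge> N"
    have "1 - 3 / real p ^ 2 \<le> content_Zp2 p (F_inv p F)"
      using p F_inv by (intro content_ge) (auto simp: N_def)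
    moreover have "content_Zp2 p (F_inv p F) \<le> 1" using p by (intro content_le_one prime_gt_0_nat)
    ultimately show "1 - 3 / real p ^ 2 \<le> M_U1 p F \<and> M_U1 p F \<le> 1" by (simp add: content_F_inv)
  qed
  have points: "(\<lambda>E. (invI E, invJ E)) ` F = local_points S"
    unfolding C(2) invariants_family S_eq ..
  have M: "M_U1 p F = content_Zp2 p (emb p ` local_points S)" for p
    unfolding M_U1_eq_content points[symmetric] image_image padic_invariants_eq ..
  have "prodinf f = prodinf g"
  \<comment> \<open>If some content vanishes, \<open>content_emb_local_points\<close> does not apply
    at the other primes, but then both products have the factor 0 at \<open>q\<close>.\<close>
  proof (cases "\<exists>q. prime q \<and> content_Zp2 q (S q) = 0")
    case True
    then obtain q where q: "prime q" "content_Zp2 q (S q) = 0" by blast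
    have "emb q ` local_points S \<subseteq> S q" using q by (auto simp: local_points_def)
    then have "M_U1 q F \<le> content_Zp2 q (S q)"
      unfolding M using q by (intro content_mono closure_of_mono prime_gt_0_nat)
    then have "M_U1 q F = 0" using q content_nonneg[of q "emb q ` local_points S"] by (simp add: M)
    then have "0 \<in> range f" "0 \<in> range g" using q by (auto simp: f_def g_def image_iff intro!: exI[of _ q])
    then show ?thesis
      using has_prod_eq_0_iff[OF convergent_prod_has_prod[OF conv_f]]
        has_prod_eq_0_iff[OF convergent_prod_has_prod[OF conv_g]] by simp
  next
    case False
    have "content_Zp2 q (S q) > 0" if "prime q" for q
      using False that content_nonneg[of q "S q"] by (auto simp: less_le)
    then have "M_U1 p F = content_Zp2 p (S p)" if "prime p" for p
      unfolding M using S fr large that by (intro content_emb_local_points[where N = N])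
    then have "f = g" by (auto simp: f_def g_def)
    then show ?thesis by simp
  qed
  then have lim: "((\<lambda>X. real (count_height_less F X) / X powr (5/6)) \<longlongrightarrow> 8 * prodinf g) at_top"
    using dens unfolding has_density_def C(2) count_family S_eq by simp
  have "(\<lambda>X. real (count_height_less F X) - 8 * X powr (5/6) * prodinf g) \<in> o[at_top](\<lambda>X. X powr (5/6))"
  proof (rule smalloI_tendsto)
    have "((\<lambda>X. real (count_height_less F X) / X powr (5/6) - 8 * prodinf g) \<longlongrightarrow> 8 * prodinf g - 8 * prodinf g) at_top"
      by (intro tendsto_intros lim)
    then have "((\<lambda>X. real (count_height_less F X) / X powr (5/6) - 8 * prodinf g) \<longlongrightarrow> 0) at_top" by simp
    then show "((\<lambda>X. (real (count_height_less F X) - 8 * X powr (5/6) * prodinf g) / X powr (5/6)) \<longlongrightarrow> 0) at_top"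
    proof (rule Lim_transform_eventually)
      show "\<forall>\<^sub>F X in at_top. real (count_height_less F X) / X powr (5/6) - 8 * prodinf g
          = (real (count_height_less F X) - 8 * X powr (5/6) * prodinf g) / X powr (5/6)"
        using eventually_gt_at_top[of 0] by eventually_elim (simp add: diff_divide_distrib)
    qed
    show "\<forall>\<^sub>F X::real in at_top. X powr (5/6) \<noteq> 0"
      using eventually_gt_at_top[of 0] by eventually_elim simp
  qed
  then show ?thesis using conv_g by (simp add: volume_R g_def[abs_def])
qed

end
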